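(* Let $q$ be a prime power. Let $s_A(n,q)$ be the proportion of separable elements in $A(n,q)$ and $s_{GL}(n,q)$ the proportion of separable elements in $GL(n,q)$, and $S_A(u,q)=\sum_{n\ge0}s_A(n,q)u^n$, $S_{GL}(u,q)=\sum_{n\ge0}s_{GL}(n,q)u^n$. Then as formal power series \[ S_A(u,q)=\prod_{d\ge1}\Bigl(1+\frac{u^d}{q^d-1}\Bigr)^{N'(d,q)}=\frac{S_{GL}(u,q)}{1+\frac{u}{q-1}}. \]
   Context: $A(n,q)$ is the group of matrices $x\in GL(n+1,q)$ with $x_{11}=1$ and $x_{j1}=0$ for $j\ge2$. A matrix is separable if its characteristic polynomial is square-free (elements of $A(n,q)$ are viewed in $GL(n+1,q)$). $GL(0,q)$ is the trivial group, so $s_{GL}(0,q)=1$. $N(d,q)$ is the number of monic irreducible polynomials of degree $d$ over $\mathbb{F}_q$; $N'(d,q)=N(d,q)$ for $d>1$ and $N'(1,q)=N(1,q)-2=q-2$. *)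

theory Defs
  imports "Jordan_Normal_Form.Char_Poly" "HOL-Computational_Algebra.Squarefree"
          "HOL-Computational_Algebra.Formal_Power_Series"
begin

definition GLmats :: "'a::{finite,field} itself \<Rightarrow> nat \<Rightarrow> 'a mat set" where
  "GLmats _ n = {x \<in> carrier_mat n n. det x \<noteq> 0}"

text \<open>A(n,q): x in GL(n+1,q) with first column e_1 (indices are 0-based here).\<close>
definition Amats :: "'a::{finite,field} itself \<Rightarrow> nat \<Rightarrow> 'a mat set" where
  "Amats T n = {x \<in> GLmats T (n+1). x $$ (0,0) = 1 \<and> (\<forall>j. 1 \<le> j \<and> j < n+1 \<longrightarrow> x $$ (j,0) = 0)}"

definition separable_mat :: "'a::field mat \<Rightarrow> bool" where
  "separable_mat x \<longleftrightarrow> squarefree (char_poly x)"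

definition s_GL :: "'a::{finite,field} itself \<Rightarrow> nat \<Rightarrow> real" where
  "s_GL T n = real (card {x \<in> GLmats T n. separable_mat x}) / real (card (GLmats T n))"

definition s_A :: "'a::{finite,field} itself \<Rightarrow> nat \<Rightarrow> real" where
  "s_A T n = real (card {x \<in> Amats T n. separable_mat x}) / real (card (Amats T n))"

definition S_GL :: "'a::{finite,field} itself \<Rightarrow> real fps" where
  "S_GL T = Abs_fps (s_GL T)"

definition S_A :: "'a::{finite,field} itself \<Rightarrow> real fps" where
  "S_A T = Abs_fps (s_A T)"

definition N_irr :: "'a::{finite,field} itself \<Rightarrow> nat \<Rightarrow> nat" where
  "N_irr _ d = card {p :: 'a poly. lead_coeff p = 1 \<and> irreducible p \<and> degree p = d}"

definition N' :: "'a::{finite,field} itself \<Rightarrow> nat \<Rightarrow> nat" where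
  "N' T d = (if d = 1 then N_irr T 1 - 2 else N_irr T d)"

end

theory Submission
  imports Defs
begin

text \<open>
  Let \<open>f\<close> be a squarefree monic polynomial of degree \<open>n\<close>, the product of a set \<open>S\<close> of monic irreducible
  polynomials. Pairs \<open>(A, v)\<close> in which the annihilator of \<open>v\<close> under \<open>A\<close> is exactly \<open>(f)\<close> correspond to
  the invertible matrices with columns \<open>v, A v, \<dots>, A^(n - 1) v\<close>. In every such pair the characteristic
  polynomial of \<open>A\<close> is \<open>f\<close>. Conversely, a matrix with characteristic polynomial \<open>f\<close> makes the vectors into
  a copy of \<open>F[X]/(f)\<close>, whose generators are its units, and there are \<open>\<Prod>p\<in>S. q ^ degree p - 1\<close> of them.
  Hence the proportion of matrices with characteristic polynomial \<open>f\<close>, relative to the general linear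
  group, is the product of the weights \<open>1 / (q ^ degree p - 1)\<close> over \<open>S\<close>, and summing over all \<open>S\<close> that
  avoid \<open>X\<close> gives the Euler product of \<open>S_GL\<close>. An element of the affine group with lower right block
  \<open>y\<close> has characteristic polynomial \<open>(X - 1) * char_poly y\<close>, so for \<open>S_A\<close> the set \<open>S\<close> must avoid
  \<open>X - 1\<close> as well.
\<close>

subsection \<open>Squarefree monic polynomials\<close>

definition monic_irreducibles :: "'a::field poly set" where
  "monic_irreducibles = {p. lead_coeff p = 1 \<and> irreducible p}"

lemma monic_irreducibles_degree_pos: "p \<in> monic_irreducibles \<Longrightarrow> 0 < degree p"
  using is_unit_iff_degree[of p]
  by (auto simp: monic_irreducibles_def irreducible_def)

lemma monic_irreducibles_prime_elem: "p \<in> monic_irreducibles \<Longrightarrow> prime_elem p"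
  by (simp add: monic_irreducibles_def field_poly_irreducible_imp_prime)

lemma monic_irreducibles_dvd_imp_eq:
  assumes "p \<in> monic_irreducibles" "r \<in> monic_irreducibles" "p dvd r"
  shows "p = r"
proof -
  from \<open>p dvd r\<close> obtain k where k: "r = p * k" ..
  have "is_unit k"
    using assms k unfolding monic_irreducibles_def irreducible_def by blast
  then obtain c where c: "k = [:c:]" "c \<noteq> 0"
    by (auto simp: is_unit_iff_degree elim: degree_eq_zeroE)
  then have "lead_coeff r = c * lead_coeff p"
    by (simp add: k lead_coeff_mult)
  then show ?thesis
    using assms k c by (simp add: monic_irreducibles_def)
qed

lemma lead_coeff_prod_monic_irreducibles:
  assumes "S \<subseteq> monic_irreducibles"
  shows "lead_coeff (\<Prod>S) = 1"
proof -
  have "lead_coeff (\<Prod>p\<in>S. p) = (\<Prod>p\<in>S. lead_coeff p)"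
    by (rule lead_coeff_prod)
  also have "\<dots> = 1"
    using assms by (intro prod.neutral) (auto simp: monic_irreducibles_def)
  finally show ?thesis by simp
qed

lemma degree_prod_monic_irreducibles:
  assumes "S \<subseteq> monic_irreducibles"
  shows "degree (\<Prod>S) = (\<Sum>p\<in>S. degree p)"
proof -
  have "degree (\<Prod>p\<in>S. p) = (\<Sum>p\<in>S. degree p)"
    using assms by (intro degree_prod_sum_eq) (auto simp: monic_irreducibles_def)
  then show ?thesis by simp
qed

lemma monic_irreducible_dvd_prod_iff:
  assumes "finite S" "S \<subseteq> monic_irreducibles" "p \<in> monic_irreducibles"
  shows "p dvd \<Prod>S \<longleftrightarrow> p \<in> S"
proof
  have "prime_elem p"
    by (rule monic_irreducibles_prime_elem[OF assms(3)])
  assume "p dvd \<Prod>S"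
  with assms(1) have "\<exists>r\<in>S. p dvd r"
    using \<open>prime_elem p\<close>
    by (induction S rule: finite_induct) (auto simp: prime_elem_dvd_mult_iff prime_elem_def)
  then show "p \<in> S"
    using assms monic_irreducibles_dvd_imp_eq by blast
qed (auto intro: dvd_prodI assms(1))

text \<open>A set \<open>S\<close> is recovered from its product as the set of monic irreducible
  divisors. This keeps the classes of matrices that belong to different \<open>S\<close>
  disjoint.\<close>

lemma prod_monic_irreducibles_inj:
  "inj_on \<Prod> {S. finite S \<and> S \<subseteq> (monic_irreducibles :: 'a::field poly set)}"
proof (rule inj_onI, safe)
  fix S R :: "'a poly set" and p
  assume *: "finite S" "S \<subseteq> monic_irreducibles" "finite R" "R \<subseteq> monic_irreducibles" "\<Prod>S = \<Prod>R"
  show "p \<in> R" if "p \<in> S"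
    using * that monic_irreducible_dvd_prod_iff[of R p] monic_irreducible_dvd_prod_iff[of S p] by auto
  show "p \<in> S" if "p \<in> R"
    using * that monic_irreducible_dvd_prod_iff[of R p] monic_irreducible_dvd_prod_iff[of S p] by auto
qed

text \<open>Distinct monic irreducibles are coprime: a new \<open>p\<close> does not divide
  \<open>\<Prod>S\<close>, so, being prime, it divides the cofactor of \<open>\<Prod>S\<close> in
  \<open>h\<close>.\<close>

lemma prod_monic_irreducibles_dvd_iff:
  assumes "finite S" "S \<subseteq> monic_irreducibles"
  shows "\<Prod>S dvd h \<longleftrightarrow> (\<forall>p\<in>S. p dvd h)"
proof
  show "\<forall>p\<in>S. p dvd h" if "\<Prod>S dvd h"
    using that dvd_trans[OF dvd_prodI[OF assms(1), of _ "\<lambda>x. x"]] by simp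
next
  show "\<Prod>S dvd h" if "\<forall>p\<in>S. p dvd h"
    using assms that
  proof (induction S rule: finite_induct)
    case (insert p S)
    then obtain k where k: "h = \<Prod>S * k"
      by (auto simp: dvd_def)
    have "\<not> p dvd \<Prod>S"
      using insert monic_irreducible_dvd_prod_iff[of S p] by auto
    moreover have "p dvd \<Prod>S * k"
      using insert k by simp
    ultimately have "p dvd k"
      using insert monic_irreducibles_prime_elem[of p] by (auto simp: prime_elem_dvd_mult_iff)
    then show ?case
      using insert k by (auto simp: mult.commute intro: mult_dvd_mono)
  qed auto
qed

lemma exists_monic_irreducible_dvd:
  fixes f :: "'a::field poly"
  assumes "0 < degree f"
  shows "\<exists>p\<in>monic_irreducibles. p dvd f"
  using assms
proof (induction "degree f" arbitrary: f rule: less_induct)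
  case less
  show ?case
  proof (cases "irreducible f")
    case True
    define p where "p = Polynomial.smult (inverse (lead_coeff f)) f"
    have nz: "lead_coeff f \<noteq> 0"
      using less by auto
    then have "p dvd f" "f dvd p"
      by (auto simp: p_def smult_dvd_iff dvd_smult)
    moreover have "irreducible p"
      using True nz irreducible_mult_unit_left[of "[:inverse (lead_coeff f):]" f]
      by (simp add: p_def is_unit_iff_degree)
    moreover have "lead_coeff p = 1"
      using nz by (simp add: p_def)
    ultimately show ?thesis
      by (auto simp: monic_irreducibles_def)
  next
    case False
    have "f \<noteq> 0" "\<not> is_unit f"
      using less by (auto simp: is_unit_iff_degree)
    then obtain a b where ab: "f = a * b" "\<not> is_unit a" "\<not> is_unit b"
      using False unfolding irreducible_def by blast
    then have nz: "a \<noteq> 0" "b \<noteq> 0"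
      using \<open>f \<noteq> 0\<close> by auto
    then have "0 < degree a" "0 < degree b"
      using ab by (auto simp: is_unit_iff_degree)
    moreover have "degree a < degree f"
      using \<open>0 < degree b\<close> nz ab by (simp add: degree_mult_eq)
    ultimately obtain p where "p \<in> monic_irreducibles" "p dvd a"
      using less by blast
    then show ?thesis
      using ab by (auto intro: dvd_mult2)
  qed
qed

text \<open>A monic irreducible \<open>p\<close> dividing \<open>x\<close> would divide the product
  twice. Cancelling one \<open>p\<close> leaves it dividing the product over \<open>S - {p}\<close>,
  which is impossible.\<close>

lemma squarefree_prod_monic_irreducibles:
  fixes S :: "'a::field poly set"
  assumes "finite S" "S \<subseteq> monic_irreducibles"
  shows "squarefree (\<Prod>S)"
proof (rule squarefreeI, rule ccontr)
  fix x assume x: "x\<^sup>2 dvd \<Prod>S" "\<not> is_unit x"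
  have "\<Prod>S \<noteq> 0"
    using lead_coeff_prod_monic_irreducibles[OF assms(2)] by auto
  then have "x \<noteq> 0"
    using x by auto
  then have "0 < degree x"
    using x by (simp add: is_unit_iff_degree)
  then obtain p where p: "p \<in> monic_irreducibles" "p dvd x"
    using exists_monic_irreducible_dvd by blast
  then have pp: "p * p dvd \<Prod>S"
    using x by (metis dvd_trans mult_dvd_mono power2_eq_square)
  then have "p \<in> S"
    using monic_irreducible_dvd_prod_iff[OF assms p(1)] by (metis dvd_mult_left)
  then have "\<Prod>S = p * \<Prod>(S - {p})"
    using assms by (simp add: prod.remove)
  then have "p dvd \<Prod>(S - {p})"
    using pp p by (auto simp: monic_irreducibles_def irreducible_def)
  then show False
    using monic_irreducible_dvd_prod_iff[of "S - {p}" p] assms p by blast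
qed

text \<open>Monic irreducible divisors are split off one at a time; squarefreeness keeps each new
  one out of the set found for the cofactor.\<close>

lemma squarefree_imp_prod_monic_irreducibles:
  fixes f :: "'a::field poly"
  assumes "squarefree f" "lead_coeff f = 1"
  shows "\<exists>S. finite S \<and> S \<subseteq> monic_irreducibles \<and> f = \<Prod>S"
  using assms
proof (induction "degree f" arbitrary: f rule: less_induct)
  case less
  show ?case
  proof (cases "degree f = 0")
    case True
    then have "f = 1"
      using less.prems by (auto simp: one_pCons elim!: degree_eq_zeroE)
    then show ?thesis
      by (intro exI[of _ "{}"]) auto
  next
    case False
    then obtain p where p: "p \<in> monic_irreducibles" "p dvd f"
      using exists_monic_irreducible_dvd by blast
    then obtain k where k: "f = p * k"
      by (auto simp: dvd_def)
    have nz: "k \<noteq> 0" "p \<noteq> 0"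
      using k less by auto
    have "lead_coeff k = 1"
      using less.prems p unfolding k by (simp add: monic_irreducibles_def lead_coeff_mult)
    moreover have "degree k < degree f"
      using nz monic_irreducibles_degree_pos[OF p(1)] by (simp add: k degree_mult_eq)
    moreover have "squarefree k"
      using less.prems k by (auto dest: squarefree_multD)
    ultimately obtain S where S: "finite S" "S \<subseteq> monic_irreducibles" "k = \<Prod>S"
      using less by blast
    have "p \<notin> S"
    proof
      assume "p \<in> S"
      then have "p\<^sup>2 dvd f"
        using S k by (auto simp: power2_eq_square intro!: mult_dvd_mono dvd_prodI)
      then show False
        using less.prems p unfolding squarefree_def monic_irreducibles_def irreducible_def by blast
    qed
    then show ?thesis
      using S p k by (intro exI[of _ "insert p S"]) auto
  qed
qed

subsection \<open>Polynomials in a matrix\<close>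

text \<open>Evaluation of \<open>p\<close> at \<open>A\<close> by Horner's scheme. The dimension is
  read off \<open>A\<close>, since matrices of all sizes share one type.\<close>

definition poly_mat :: "'a::comm_ring_1 mat \<Rightarrow> 'a poly \<Rightarrow> 'a mat" where
  "poly_mat A p = fold_coeffs (\<lambda>a N. a \<cdot>\<^sub>m 1\<^sub>m (dim_row A) + A * N) p (0\<^sub>m (dim_row A) (dim_row A))"

lemma poly_mat_0 [simp]: "A \<in> carrier_mat n n \<Longrightarrow> poly_mat A 0 = 0\<^sub>m n n"
  by (auto simp: poly_mat_def)

lemma poly_mat_pCons:
  assumes "A \<in> carrier_mat n n"
  shows "poly_mat A (pCons a p) = a \<cdot>\<^sub>m 1\<^sub>m n + A * poly_mat A p"
proof (cases "p = 0 \<and> a = 0")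
  case True
  then show ?thesis
    using assms by (auto simp: poly_mat_def)
next
  case False
  then show ?thesis
    using assms by (auto simp: poly_mat_def fold_coeffs_pCons_not_0_0_eq fold_coeffs_pCons_coeff_not_0_eq)
qed

lemma poly_mat_carrier [simp]:
  assumes "A \<in> carrier_mat n n"
  shows "poly_mat A p \<in> carrier_mat n n"
  by (induction p) (use assms in \<open>auto simp: poly_mat_pCons\<close>)

lemma poly_mat_dims [simp]:
  assumes "A \<in> carrier_mat n n"
  shows "dim_row (poly_mat A p) = n" "dim_col (poly_mat A p) = n"
  using poly_mat_carrier[OF assms] by auto

lemma zero_smult_one_mat: "(0 :: 'a::comm_ring_1) \<cdot>\<^sub>m 1\<^sub>m n = 0\<^sub>m n n"
  by (intro eq_matI) auto

lemma poly_mat_add: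
  assumes A: "A \<in> carrier_mat n n"
  shows "poly_mat A (p + r) = poly_mat A p + poly_mat A r"
proof (induction p r rule: poly_induct2)
  case (pCons a p b r)
  have "A * (poly_mat A p + poly_mat A r) = A * poly_mat A p + A * poly_mat A r"
    using A by (intro mult_add_distrib_mat[of _ n n _ n]) auto
  then show ?case
    using A pCons
    by (intro eq_matI) (auto simp: poly_mat_pCons[OF A] algebra_simps simp del: index_mult_mat(1))
qed (use A in auto)

lemma poly_mat_smult:
  assumes A: "A \<in> carrier_mat n n"
  shows "poly_mat A (Polynomial.smult c p) = c \<cdot>\<^sub>m poly_mat A p"
proof (induction p)
  case (pCons a p)
  have "A * (c \<cdot>\<^sub>m poly_mat A p) = c \<cdot>\<^sub>m (A * poly_mat A p)"
    using A by (intro mult_smult_distrib[of _ n n _ n]) auto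
  then show ?case
    using A pCons
    by (intro eq_matI) (auto simp: poly_mat_pCons[OF A] algebra_simps simp del: index_mult_mat(1))
qed (use A in auto)

text \<open>With additivity this makes evaluation at \<open>A\<close> a ring homomorphism, so
  \<open>carrier_vec n\<close> becomes a module over F[X] on which X acts as
  \<open>A\<close>.\<close>

lemma poly_mat_mult:
  assumes A: "A \<in> carrier_mat n n"
  shows "poly_mat A (p * r) = poly_mat A p * poly_mat A r"
proof (induction p)
  case (pCons a p)
  have "A * (poly_mat A p * poly_mat A r) \<in> carrier_mat n n"
    using A by (intro mult_carrier_mat[of _ n n]) auto
  then have "poly_mat A (pCons a p * r) = a \<cdot>\<^sub>m poly_mat A r + A * (poly_mat A p * poly_mat A r)"
    using A pCons by (simp add: poly_mat_add[OF A] poly_mat_smult[OF A] poly_mat_pCons[OF A]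
        zero_smult_one_mat left_add_zero_mat[of _ n n])
  also have "\<dots> = (a \<cdot>\<^sub>m 1\<^sub>m n) * poly_mat A r + (A * poly_mat A p) * poly_mat A r"
    using A by (simp add: mult_smult_assoc_mat[of _ n n _ n] assoc_mult_mat[of _ n n _ n _ n]
        left_mult_one_mat[of _ n n])
  also have "\<dots> = (a \<cdot>\<^sub>m 1\<^sub>m n + A * poly_mat A p) * poly_mat A r"
    using A by (intro add_mult_distrib_mat[symmetric]) auto
  finally show ?case
    by (simp add: poly_mat_pCons[OF A])
qed (use A in \<open>auto simp: left_mult_zero_mat[of _ n n]\<close>)

lemma poly_mat_1 [simp]:
  assumes A: "A \<in> carrier_mat n n"
  shows "poly_mat A 1 = 1\<^sub>m n"
  using A unfolding one_pCons poly_mat_pCons[OF A] by (intro eq_matI) auto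

lemma poly_mat_X:
  assumes A: "A \<in> carrier_mat n n"
  shows "poly_mat A [:0, 1:] = A"
  using A unfolding poly_mat_pCons[OF A] by (intro eq_matI) auto

text \<open>This is \<open>p(X) - p(A) = (X - A) Q(X)\<close>, the factor theorem over a matrix ring.\<close>

lemma char_poly_matrix_left_dvd:
  fixes A :: "'a::comm_ring_1 mat"
  assumes A: "A \<in> carrier_mat n n"
  shows "\<exists>Q\<in>carrier_mat n n.
    p \<cdot>\<^sub>m 1\<^sub>m n - map_mat (\<lambda>a. [:a:]) (poly_mat A p) = char_poly_matrix A * Q"
proof (induction p)
  case 0
  show ?case
    using A by (intro bexI[of _ "0\<^sub>m n n"]) (auto simp: right_mult_zero_mat[of _ n n])
next
  case (pCons a p)
  let ?L = "map_mat (\<lambda>a::'a. [:a:])" and ?C = "char_poly_matrix A" and ?X = "[:0,1:] :: 'a poly"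
  define N where "N = poly_mat A p"
  define AN where "AN = A * N"
  have N: "N \<in> carrier_mat n n" and AN: "AN \<in> carrier_mat n n"
    using A by (auto simp: N_def AN_def)
  obtain Q where Q: "Q \<in> carrier_mat n n" "p \<cdot>\<^sub>m 1\<^sub>m n - ?L N = ?C * Q"
    using pCons by (auto simp: N_def)
  have C: "?C \<in> carrier_mat n n"
    using A by simp
  have "?C = ?X \<cdot>\<^sub>m 1\<^sub>m n - ?L A"
    using A by (intro eq_matI) (auto simp: char_poly_matrix_def)
  then have "?C * ?L N = (?X \<cdot>\<^sub>m 1\<^sub>m n) * ?L N - ?L A * ?L N"
    using A N by (simp add: minus_mult_distrib_mat[of _ n n _ _ n])
  also have "\<dots> = ?X \<cdot>\<^sub>m ?L N - ?L AN"
    using A N by (simp add: map_poly_mult(1)[OF A N] AN_def mult_smult_assoc_mat[of _ n n _ n]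
        left_mult_one_mat[of _ n n])
  finally have CN: "?C * ?L N = ?X \<cdot>\<^sub>m ?L N - ?L AN" .
  \<comment> \<open>The new quotient comes from
    \<open>X p(X) - A p(A) = X (p(X) - p(A)) + (X - A) p(A)\<close>; the constant \<open>a\<close>
    cancels on the left.\<close>
  have "?C * (?X \<cdot>\<^sub>m Q + ?L N) = ?X \<cdot>\<^sub>m (?C * Q) + ?C * ?L N"
    using C N Q by (simp add: mult_add_distrib_mat[of _ n n _ n] mult_smult_distrib[of _ n n _ n])
  also have "\<dots> = ?X \<cdot>\<^sub>m (p \<cdot>\<^sub>m 1\<^sub>m n - ?L N) + (?X \<cdot>\<^sub>m ?L N - ?L AN)"
    unfolding CN Q(2) ..
  also have "\<dots> = pCons a p \<cdot>\<^sub>m 1\<^sub>m n - ?L (poly_mat A (pCons a p))"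
    unfolding poly_mat_pCons[OF A] N_def[symmetric] AN_def[symmetric]
    using N AN by (intro eq_matI) auto
  finally show ?case
    using Q N by (intro bexI[of _ "?X \<cdot>\<^sub>m Q + ?L N"]) auto
qed

text \<open>Substituting \<open>p\<close> for X is a ring homomorphism, so it commutes with the
  determinant; applied entrywise it turns X - \<open>N\<close> into \<open>p\<close> -
  \<open>N\<close>.\<close>

lemma det_smult_one_minus_const:
  fixes N :: "'a::comm_ring_1 mat"
  assumes N: "N \<in> carrier_mat n n"
  shows "det (p \<cdot>\<^sub>m 1\<^sub>m n - map_mat (\<lambda>a. [:a:]) N) = pcompose (char_poly N) p"
proof -
  have "map_mat (\<lambda>r. pcompose r p) (char_poly_matrix N) = p \<cdot>\<^sub>m 1\<^sub>m n - map_mat (\<lambda>a. [:a:]) N"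
    using N by (intro eq_matI) (auto simp: char_poly_matrix_def pcompose_pCons)
  then show ?thesis
    by (metis char_poly_def comm_ring_hom.hom_det[OF pcompose_hom.comm_ring_hom_axioms])
qed

text \<open>Taking determinants in p(X) - p(A) = (X - A) Q(X) shows that \<open>p\<close> divides
  the characteristic polynomial of p(A) evaluated at \<open>p\<close>. This forces 0 to be an
  eigenvalue of p(A).\<close>

lemma dvd_char_poly_imp_singular:
  fixes A :: "'a::field mat"
  assumes A: "A \<in> carrier_mat n n" and p: "p dvd char_poly A" "0 < degree p"
  shows "\<exists>w\<in>carrier_vec n. w \<noteq> 0\<^sub>v n \<and> poly_mat A p *\<^sub>v w = 0\<^sub>v n"
proof -
  define N where "N = poly_mat A p"
  have N: "N \<in> carrier_mat n n"
    using A by (simp add: N_def)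
  obtain Q where Q: "Q \<in> carrier_mat n n"
    "p \<cdot>\<^sub>m 1\<^sub>m n - map_mat (\<lambda>a. [:a:]) N = char_poly_matrix A * Q"
    using char_poly_matrix_left_dvd[OF A] N_def by blast
  then have "pcompose (char_poly N) p = char_poly A * det Q"
    using A det_smult_one_minus_const[OF N, of p] by (simp add: det_mult[of _ n] char_poly_def)
  then have "p dvd pcompose (char_poly N) p"
    using p by simp
  moreover obtain c r where cr: "char_poly N = pCons c r"
    by (cases "char_poly N")
  \<comment> \<open>The composition is \<open>c\<close> plus a multiple of \<open>p\<close>, so only
    the constant coefficient remains. As \<open>p\<close> is not constant, that coefficient
    vanishes.\<close>
  ultimately have "p dvd [:c:]"
    by (simp add: pcompose_pCons dvd_add_left_iff)
  then have "c = 0"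
    using p(2) by (metis degree_pCons_0 dvd_imp_degree_le leD pCons_eq_0_iff)
  then have "eigenvalue N 0"
    using eigenvalue_root_char_poly[OF N, of 0] cr by simp
  then obtain w where "w \<in> carrier_vec n" "w \<noteq> 0\<^sub>v n" "N *\<^sub>v w = 0 \<cdot>\<^sub>v w"
    using N by (auto simp: eigenvalue_def eigenvector_def)
  then show ?thesis
    unfolding N_def by (intro bexI[of _ w]) auto
qed

subsection \<open>Cyclic vectors\<close>

lemma poly_mat_mult_vec:
  assumes A: "A \<in> carrier_mat n n" and v: "v \<in> carrier_vec n"
  shows "poly_mat A (p * r) *\<^sub>v v = poly_mat A p *\<^sub>v (poly_mat A r *\<^sub>v v)"
  using A v by (simp add: poly_mat_mult[OF A] assoc_mult_mat_vec[of _ n n _ n])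

lemma poly_mat_add_vec:
  assumes A: "A \<in> carrier_mat n n" and v: "v \<in> carrier_vec n"
  shows "poly_mat A (p + r) *\<^sub>v v = poly_mat A p *\<^sub>v v + poly_mat A r *\<^sub>v v"
  using A v by (simp add: poly_mat_add[OF A] add_mult_distrib_mat_vec[of _ n n])

lemma poly_mat_smult_vec:
  assumes A: "A \<in> carrier_mat n n" and v: "v \<in> carrier_vec n"
  shows "poly_mat A (Polynomial.smult c r) *\<^sub>v v = c \<cdot>\<^sub>v (poly_mat A r *\<^sub>v v)"
  using A v by (intro eq_vecI) (auto simp: poly_mat_smult[OF A])

lemma poly_mat_uminus_vec:
  assumes A: "A \<in> carrier_mat n n" and v: "v \<in> carrier_vec n"
  shows "poly_mat A (- r) *\<^sub>v v = - (poly_mat A r *\<^sub>v v)"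
  using A v poly_mat_smult_vec[OF A v, of "- 1" r] by (intro eq_vecI) auto

lemma poly_mat_diff_vec:
  assumes A: "A \<in> carrier_mat n n" and v: "v \<in> carrier_vec n"
  shows "poly_mat A (p - r) *\<^sub>v v = poly_mat A p *\<^sub>v v - poly_mat A r *\<^sub>v v"
  using poly_mat_add_vec[OF A v, of p "- r"] poly_mat_uminus_vec[OF A v, of r] A v
  by (intro eq_vecI) auto

lemma poly_mat_vec_carrier [simp]:
  "A \<in> carrier_mat n n \<Longrightarrow> v \<in> carrier_vec n \<Longrightarrow> poly_mat A h *\<^sub>v v \<in> carrier_vec n"
  by (intro mult_mat_vec_carrier[of _ n n]) auto

lemma mult_mat_zero_vec:
  fixes B :: "'a::comm_ring_1 mat"
  assumes "B \<in> carrier_mat m n"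
  shows "B *\<^sub>v 0\<^sub>v n = 0\<^sub>v m"
  using assms by (intro eq_vecI) auto

text \<open>The annihilator of \<open>v\<close> in the F[X]-module given by \<open>A\<close> is the
  ideal generated by \<open>f\<close>; for monic \<open>f\<close> this is the minimal polynomial of
  \<open>v\<close> relative to \<open>A\<close>.\<close>

definition exact_annihilator :: "'a::field mat \<Rightarrow> 'a vec \<Rightarrow> 'a poly \<Rightarrow> bool" where
  "exact_annihilator A v f \<longleftrightarrow> (\<forall>h. poly_mat A h *\<^sub>v v = 0\<^sub>v (dim_row A) \<longleftrightarrow> f dvd h)"

lemma exact_annihilator_iff:
  "exact_annihilator A v f \<Longrightarrow> A \<in> carrier_mat n n \<Longrightarrow> poly_mat A h *\<^sub>v v = 0\<^sub>v n \<longleftrightarrow> f dvd h"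
  by (auto simp: exact_annihilator_def)

text \<open>The annihilator of \<open>w\<close> is a proper ideal because \<open>w\<close> is
  nonzero. Its generator is a non-unit that divides the irreducible \<open>p\<close>, so it is
  associated to \<open>p\<close>.\<close>

lemma exact_annihilator_irreducible:
  fixes A :: "'a::field mat"
  assumes A: "A \<in> carrier_mat n n" and w: "w \<in> carrier_vec n" "w \<noteq> 0\<^sub>v n"
    and p: "irreducible p" "poly_mat A p *\<^sub>v w = 0\<^sub>v n"
  shows "exact_annihilator A w p"
proof -
  \<comment> \<open>A nonzero annihilating polynomial of least degree generates the ideal, by
    division with remainder.\<close>
  define I where "I = {h. h \<noteq> 0 \<and> poly_mat A h *\<^sub>v w = 0\<^sub>v n}"
  have "p \<in> I"
    using p by (auto simp: I_def)
  then obtain g where g: "g \<in> I" "\<And>h. h \<in> I \<Longrightarrow> degree g \<le> degree h"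
    using arg_min_nat_lemma[of "\<lambda>h. h \<in> I" p degree] by metis
  have g_dvd: "g dvd h" if h: "poly_mat A h *\<^sub>v w = 0\<^sub>v n" for h
  proof -
    have "poly_mat A (h div g * g) *\<^sub>v w = 0\<^sub>v n"
      using g(1) A w by (auto simp: I_def poly_mat_mult_vec[OF A w(1)] mult_mat_zero_vec[of _ n n])
    then have "poly_mat A (h mod g) *\<^sub>v w = 0\<^sub>v n"
      using h poly_mat_diff_vec[OF A w(1), of h "h div g * g"] by (simp add: minus_div_mult_eq_mod)
    then have "h mod g = 0"
      using g degree_mod_less[of g h] by (force simp: I_def)
    then show ?thesis
      by auto
  qed
  have "g dvd p"
    using g_dvd p by simp
  then obtain k where k: "p = g * k" ..
  have "\<not> is_unit g"
  proof
    assume "is_unit g"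
    then obtain u where u: "u * g = 1"
      by (metis dvdE mult.commute)
    have "w = poly_mat A (u * g) *\<^sub>v w"
      using A w by (simp add: u)
    also have "\<dots> = 0\<^sub>v n"
      using g(1) A w by (auto simp: I_def poly_mat_mult_vec[OF A w(1)] mult_mat_zero_vec[of _ n n])
    finally show False
      using w by simp
  qed
  then have "is_unit k"
    using p(1) k by (auto dest: irreducibleD)
  then have pg: "p dvd g"
    unfolding k by (simp add: mult_unit_dvd_iff)
  show ?thesis
    unfolding exact_annihilator_def
  proof (intro allI iffI)
    fix h
    show "p dvd h" if "poly_mat A h *\<^sub>v w = 0\<^sub>v (dim_row A)"
      using that A g_dvd pg dvd_trans by auto
    show "poly_mat A h *\<^sub>v w = 0\<^sub>v (dim_row A)" if "p dvd h"
    proof -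
      from that obtain k where "h = k * p"
        by (metis dvdE mult.commute)
      then show ?thesis
        using p A w by (auto simp: poly_mat_mult_vec[OF A w(1)] mult_mat_zero_vec[of _ n n])
    qed
  qed
qed

text \<open>Annihilators of coprime generators multiply when vectors are added. Each
  \<open>p\<close> in \<open>S\<close> contributes a nonzero vector killed by p(A), and the sum of
  these vectors is the witness.\<close>

lemma exact_annihilator_prod:
  fixes A :: "'a::field mat"
  assumes A: "A \<in> carrier_mat n n" and S: "finite S" "S \<subseteq> monic_irreducibles"
    and dvd: "\<And>p. p \<in> S \<Longrightarrow> p dvd char_poly A"
  shows "\<exists>v\<in>carrier_vec n. exact_annihilator A v (\<Prod>S)"
  using S dvd
proof (induction S rule: finite_induct)
  case empty
  show ?case
    \<comment> \<open>The empty product 1 divides every polynomial, and every polynomial kills the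
      zero vector.\<close>
    using A by (intro bexI[of _ "0\<^sub>v n"]) (auto simp: exact_annihilator_def mult_mat_zero_vec[of _ n n])
next
  case (insert p S)
  then obtain v where v: "v \<in> carrier_vec n" "exact_annihilator A v (\<Prod>S)"
    by auto
  have p: "p \<in> monic_irreducibles" "p dvd char_poly A" and pS: "\<Prod>(insert p S) = p * \<Prod>S"
    using insert by auto
  obtain w where w: "w \<in> carrier_vec n" "w \<noteq> 0\<^sub>v n" "poly_mat A p *\<^sub>v w = 0\<^sub>v n"
    using dvd_char_poly_imp_singular[OF A p(2) monic_irreducibles_degree_pos[OF p(1)]] by auto
  then have w': "exact_annihilator A w p"
    using p by (intro exact_annihilator_irreducible[OF A]) (auto simp: monic_irreducibles_def)
  have act: "poly_mat A h *\<^sub>v (v + w) = poly_mat A h *\<^sub>v v + poly_mat A h *\<^sub>v w" for h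
    using A v w by (simp add: mult_add_distrib_mat_vec[of _ n n])
  have "p * \<Prod>S dvd h" if h: "poly_mat A h *\<^sub>v (v + w) = 0\<^sub>v n" for h
  proof -
    have kill: "poly_mat A (r * h) *\<^sub>v (v + w) = 0\<^sub>v n" for r
      using h A v w by (simp add: poly_mat_mult_vec[OF A] mult_mat_zero_vec[of _ n n])
    \<comment> \<open>Multiplying by \<open>p\<close> removes the component \<open>w\<close> and
      gives a condition on \<open>v\<close> alone; multiplying by \<open>\<Prod>S\<close> below
      isolates \<open>w\<close> in the same way.\<close>
    have "poly_mat A (p * h) *\<^sub>v w = 0\<^sub>v n"
      using w' A by (simp add: exact_annihilator_def)
    then have "poly_mat A (p * h) *\<^sub>v v = 0\<^sub>v n"
      using kill[of p] A v right_zero_vec[of "poly_mat A (p * h) *\<^sub>v v" n] unfolding act by simp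
    then have "\<Prod>S dvd p * h"
      using v A by (simp add: exact_annihilator_def)
    then have "\<forall>r\<in>S. r dvd p * h"
      using insert by (subst (asm) prod_monic_irreducibles_dvd_iff) auto
    moreover have "\<not> r dvd p" if "r \<in> S" for r
      using that insert monic_irreducibles_dvd_imp_eq[of r p] by auto
    ultimately have "\<forall>r\<in>S. r dvd h"
      using insert(4) monic_irreducibles_prime_elem by (metis insert_subset prime_elem_dvd_mult_iff subsetD)
    moreover have "poly_mat A (\<Prod>S * h) *\<^sub>v v = 0\<^sub>v n"
      using v A by (simp add: exact_annihilator_def)
    then have "poly_mat A (\<Prod>S * h) *\<^sub>v w = 0\<^sub>v n"
      using kill[of "\<Prod>S"] A w left_zero_vec[of "poly_mat A (\<Prod>S * h) *\<^sub>v w" n] unfolding act by simp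
    then have "p dvd \<Prod>S * h"
      using w' A by (simp add: exact_annihilator_def)
    then have "p dvd h"
      using insert monic_irreducible_dvd_prod_iff[of S p] monic_irreducibles_prime_elem[of p]
      by (auto simp: prime_elem_dvd_mult_iff)
    ultimately show ?thesis
      using insert prod_monic_irreducibles_dvd_iff[of "insert p S" h] by auto
  qed
  moreover have "poly_mat A h *\<^sub>v (v + w) = 0\<^sub>v n" if "p * \<Prod>S dvd h" for h
  proof -
    have "p dvd h" "\<Prod>S dvd h"
      using that by (auto dest: dvd_mult_left dvd_mult_right)
    then show ?thesis
      unfolding act by (simp add: exact_annihilator_iff[OF v(2) A] exact_annihilator_iff[OF w' A]
          iffD2[OF exact_annihilator_iff[OF v(2) A]] iffD2[OF exact_annihilator_iff[OF w' A]])
  qed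
  ultimately have "exact_annihilator A (v + w) (\<Prod>(insert p S))"
    using A unfolding pS exact_annihilator_def by auto
  then show ?case
    using v(1) w(1) by (intro bexI[of _ "v + w"]) auto
qed

section \<open>Residues modulo a polynomial and Chinese remaindering\<close>

definition polys_below :: "nat \<Rightarrow> 'a::zero poly set" where
  "polys_below n = {h. h = 0 \<or> degree h < n}"

lemma zero_in_polys_below: "0 \<in> polys_below n"
  by (simp add: polys_below_def)

lemma mod_in_polys_below: "f \<noteq> 0 \<Longrightarrow> (h :: 'a::field poly) mod f \<in> polys_below (degree f)"
  using degree_mod_less[of f h] by (auto simp: polys_below_def)

lemma polys_below_diff:
  "f \<in> polys_below n \<Longrightarrow> g \<in> polys_below n \<Longrightarrow> f - (g :: 'a::field poly) \<in> polys_below n"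
  using degree_diff_less[of f n g] by (cases n) (auto simp: polys_below_def)

lemma polys_below_dvd_imp_0:
  "f \<in> polys_below (degree g) \<Longrightarrow> g dvd f \<Longrightarrow> f = (0 :: 'a::field poly)"
  by (rule ccontr) (use dvd_imp_degree_le[of g f] in \<open>auto simp: polys_below_def\<close>)

lemma polys_below_mod_eq: "h \<in> polys_below (degree f) \<Longrightarrow> h mod f = (h :: 'a::field poly)"
  by (auto simp: polys_below_def mod_poly_less)

lemma coeff_vec_bij:
  "bij_betw (\<lambda>h. vec n (coeff h)) (polys_below n) (carrier_vec n :: 'a::comm_ring_1 vec set)"
proof (rule bij_betw_byWitness[where f' = "\<lambda>v. Poly (list_of_vec v)"])
  show "\<forall>h\<in>polys_below n. Poly (list_of_vec (vec n (coeff h))) = (h :: 'a poly)"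
    by (auto simp: poly_eq_iff nth_default_def list_of_vec_index polys_below_def
        intro!: coeff_eq_0)
  show "\<forall>v\<in>carrier_vec n. vec n (coeff (Poly (list_of_vec v))) = (v :: 'a vec)"
    by (auto intro!: eq_vecI simp: nth_default_def list_of_vec_index)
  show "(\<lambda>v. Poly (list_of_vec v)) ` carrier_vec n \<subseteq> (polys_below n :: 'a poly set)"
  proof safe
    fix v :: "'a vec" assume v: "v \<in> carrier_vec n"
    have "coeff (Poly (list_of_vec v)) i = 0" if "i \<ge> n" for i
      using v that by (simp add: nth_default_def)
    then show "Poly (list_of_vec v) \<in> polys_below n"
      unfolding polys_below_def by (metis (mono_tags) leading_coeff_0_iff linorder_not_le mem_Collect_eq)
  qed
qed auto

lemma card_finite_carrier_vec:
  "finite (carrier_vec n :: 'a::finite vec set) \<and> card (carrier_vec n :: 'a vec set) = card (UNIV :: 'a set) ^ n"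
proof -
  have bij: "bij_betw vec_of_list {xs :: 'a list. set xs \<subseteq> UNIV \<and> length xs = n} (carrier_vec n)"
    by (rule bij_betw_byWitness[where f' = list_of_vec])
      (auto simp: vec_list list_vec intro: carrier_vecI)
  show ?thesis
    using bij_betw_finite[OF bij] bij_betw_same_card[OF bij] card_lists_length_eq[of "UNIV :: 'a set" n]
      finite_lists_length_eq[of "UNIV :: 'a set" n] by simp
qed

lemma finite_polys_below: "finite (polys_below n :: 'a::{finite,comm_ring_1} poly set)"
  using bij_betw_finite[OF coeff_vec_bij[where 'a = 'a, of n]]
    card_finite_carrier_vec[where 'a = 'a, of n] by simp

lemma card_polys_below: "card (polys_below n :: 'a::{finite,comm_ring_1} poly set) = card (UNIV :: 'a set) ^ n"
  using bij_betw_same_card[OF coeff_vec_bij[where 'a = 'a, of n]]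
    card_finite_carrier_vec[where 'a = 'a, of n] by simp

text \<open>The Chinese remainder theorem, proved by counting: reduction modulo all \<open>p \<in> S\<close> is injective
  between sets of equal size.\<close>

lemma chinese_remainder_monic_irreducibles:
  fixes S :: "'a::{finite,field} poly set"
  assumes S: "finite S" "S \<subseteq> monic_irreducibles"
  shows "bij_betw (\<lambda>h. \<lambda>p\<in>S. h mod p) (polys_below (degree (\<Prod>S)))
    (PiE S (\<lambda>p. polys_below (degree p)))"
proof -
  let ?F = "\<lambda>h. \<lambda>p\<in>S. h mod p" and ?A = "polys_below (degree (\<Prod>S)) :: 'a poly set"
    and ?B = "PiE S (\<lambda>p. polys_below (degree p) :: 'a poly set)"
  have inj: "inj_on ?F ?A"
  proof (rule inj_onI)
    fix g h assume gh: "g \<in> ?A" "h \<in> ?A" "?F g = ?F h"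
    then have "g mod p = h mod p" if "p \<in> S" for p
      using that by (metis restrict_apply')
    then have "\<forall>p\<in>S. p dvd g - h"
      by (simp add: mod_eq_dvd_iff)
    then have "\<Prod>S dvd g - h"
      using prod_monic_irreducibles_dvd_iff[OF S] by blast
    then show "g = h"
      using polys_below_dvd_imp_0[OF polys_below_diff[OF gh(1,2)]] by simp
  qed
  have sub: "?F ` ?A \<subseteq> ?B"
    using S monic_irreducibles_degree_pos by (fastforce intro: mod_in_polys_below)
  have "card ?B = card (UNIV :: 'a set) ^ (\<Sum>p\<in>S. degree p)"
    using S by (simp add: card_PiE card_polys_below power_sum)
  then have card: "card ?B = card ?A"
    by (simp add: card_polys_below degree_prod_monic_irreducibles[OF S(2)])
  have "finite ?B"
    using S by (intro finite_PiE finite_polys_below) auto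
  then have "?F ` ?A = ?B"
    using sub card_image[OF inj] card by (intro card_subset_eq) auto
  then show ?thesis
    using inj by (simp add: bij_betw_def)
qed

text \<open>This is the order of the unit group of F[X] modulo \<open>\<Prod>S\<close>: under the
  Chinese remainder bijection the units are the tuples without a zero component.\<close>

lemma card_polys_below_not_dvd:
  fixes S :: "'a::{finite,field} poly set"
  assumes S: "finite S" "S \<subseteq> monic_irreducibles"
  shows "card {h \<in> polys_below (degree (\<Prod>S)). \<forall>p\<in>S. \<not> p dvd h} = (\<Prod>p\<in>S. card (UNIV :: 'a set) ^ degree p - 1)"
proof -
  let ?F = "\<lambda>h. \<lambda>p\<in>S. h mod p" and ?A = "polys_below (degree (\<Prod>S)) :: 'a poly set"
    and ?B = "PiE S (\<lambda>p. polys_below (degree p) :: 'a poly set)"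
    and ?B' = "PiE S (\<lambda>p. polys_below (degree p) - {0} :: 'a poly set)"
  note bij = chinese_remainder_monic_irreducibles[OF S]
  have img: "?F ` {h \<in> ?A. \<forall>p\<in>S. \<not> p dvd h} = ?B'"
  proof (intro equalityI subsetI)
    fix g assume "g \<in> ?F ` {h \<in> ?A. \<forall>p\<in>S. \<not> p dvd h}"
    then obtain h where h: "g = ?F h" "h \<in> ?A" "\<forall>p\<in>S. \<not> p dvd h"
      by blast
    then have "g \<in> ?B"
      using bij bij_betwE by blast
    moreover have "g p \<noteq> 0" if "p \<in> S" for p
      using h that by (auto simp: mod_eq_0_iff_dvd)
    ultimately show "g \<in> ?B'"
      by (auto simp: PiE_iff)
  next
    fix g assume g: "g \<in> ?B'"
    then have "g \<in> ?B"
      by (auto simp: PiE_iff)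
    then have "g \<in> ?F ` ?A"
      by (simp only: bij_betw_imp_surj_on[OF bij])
    then obtain h where h: "h \<in> ?A" "g = ?F h"
      by (elim imageE)
    have "\<not> p dvd h" if "p \<in> S" for p
      using g h that by (auto simp: PiE_iff mod_eq_0_iff_dvd)
    then show "g \<in> ?F ` {h \<in> ?A. \<forall>p\<in>S. \<not> p dvd h}"
      using h by blast
  qed
  have inj: "inj_on ?F {h \<in> ?A. \<forall>p\<in>S. \<not> p dvd h}"
    using bij by (auto simp: bij_betw_def intro: inj_on_subset)
  have "card {h \<in> ?A. \<forall>p\<in>S. \<not> p dvd h} = card ?B'"
    using card_image[OF inj] by (simp only: img)
  also have "\<dots> = (\<Prod>p\<in>S. card (polys_below (degree p) - {0} :: 'a poly set))"
    using S by (simp add: card_PiE)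
  also have "\<dots> = (\<Prod>p\<in>S. card (UNIV :: 'a set) ^ degree p - 1)"
    by (intro prod.cong) (simp_all add: card_Diff_singleton card_polys_below zero_in_polys_below)
  finally show ?thesis .
qed

section \<open>Counting cyclic vectors\<close>

text \<open>The map is injective because \<open>f\<close> divides no nonzero polynomial of smaller
  degree, and both sides have q^n elements. It identifies the vectors with F[X]/(f).\<close>

lemma cyclic_vector_bij:
  fixes A :: "'a::{finite,field} mat"
  assumes A: "A \<in> carrier_mat n n" and v: "v \<in> carrier_vec n"
    and f: "exact_annihilator A v f" "degree f = n"
  shows "bij_betw (\<lambda>h. poly_mat A h *\<^sub>v v) (polys_below n) (carrier_vec n)"
proof -
  let ?F = "\<lambda>h. poly_mat A h *\<^sub>v v"
  have inj: "inj_on ?F (polys_below n)"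
  proof (rule inj_onI)
    fix g h assume gh: "g \<in> polys_below n" "h \<in> polys_below n" "?F g = ?F h"
    then have "poly_mat A (g - h) *\<^sub>v v = 0\<^sub>v n"
      using A v poly_mat_diff_vec[OF A v, of g h] by simp
    then have "f dvd g - h"
      using exact_annihilator_iff[OF f(1) A] by blast
    then show "g = h"
      using polys_below_dvd_imp_0 polys_below_diff[OF gh(1,2)] f(2) by force
  qed
  have "card (carrier_vec n :: 'a vec set) = card (polys_below n :: 'a poly set)"
    using card_finite_carrier_vec[where 'a = 'a] card_polys_below by metis
  then have "?F ` polys_below n = carrier_vec n"
    using A v card_image[OF inj] card_finite_carrier_vec by (intro card_subset_eq) auto
  then show ?thesis
    using inj by (simp add: bij_betw_def)
qed

text \<open>Once one generator \<open>v\<close> is fixed, every vector is h(A) v for a unique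
  residue \<open>h\<close>, and it is again a generator exactly when \<open>h\<close> is a unit
  modulo \<open>\<Prod>S\<close>.\<close>

lemma card_cyclic_vectors:
  fixes A :: "'a::{finite,field} mat"
  assumes A: "A \<in> carrier_mat n n" and S: "finite S" "S \<subseteq> monic_irreducibles"
    and cp: "char_poly A = \<Prod>S"
  shows "card {v \<in> carrier_vec n. exact_annihilator A v (\<Prod>S)} = (\<Prod>p\<in>S. card (UNIV :: 'a set) ^ degree p - 1)"
proof -
  have deg: "degree (\<Prod>S) = n"
    using degree_monic_char_poly[OF A] cp by simp
  obtain v where v: "v \<in> carrier_vec n" "exact_annihilator A v (\<Prod>S)"
    using exact_annihilator_prod[OF A S] monic_irreducible_dvd_prod_iff[OF S] S cp by auto
  let ?F = "\<lambda>h. poly_mat A h *\<^sub>v v"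
  note bij = cyclic_vector_bij[OF A v deg]
  have iff: "exact_annihilator A (?F h) (\<Prod>S) \<longleftrightarrow> (\<forall>p\<in>S. \<not> p dvd h)" for h
  proof -
    have *: "poly_mat A k *\<^sub>v ?F h = 0\<^sub>v n \<longleftrightarrow> \<Prod>S dvd k * h" for k
      using poly_mat_mult_vec[OF A v(1), of k h] exact_annihilator_iff[OF v(2) A, of "k * h"] by simp
    show ?thesis
    proof
      assume h: "exact_annihilator A (?F h) (\<Prod>S)"
      show "\<forall>p\<in>S. \<not> p dvd h"
      proof (intro ballI notI)
        fix p assume p: "p \<in> S" "p dvd h"
        \<comment> \<open>If \<open>p\<close> divides \<open>h\<close>, the smaller product over
          \<open>S - {p}\<close> already kills h(A) v, contradicting exactness.\<close>
        then have "\<Prod>S dvd \<Prod>(S - {p}) * h"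
          using S by (simp add: prod.remove[of S p] mult.commute mult_dvd_mono)
        then have "\<Prod>S dvd \<Prod>(S - {p})"
          using h A by (simp add: exact_annihilator_def *)
        then have "p dvd \<Prod>(S - {p})"
          using p S by (auto intro: dvd_trans dvd_prodI)
        then show False
          using monic_irreducible_dvd_prod_iff[of "S - {p}" p] S p by blast
      qed
    next
      assume "\<forall>p\<in>S. \<not> p dvd h"
      then have "p dvd k * h \<longleftrightarrow> p dvd k" if "p \<in> S" for p k
        using that S(2) prime_elem_dvd_mult_iff[OF monic_irreducibles_prime_elem] by blast
      then have "\<Prod>S dvd k * h \<longleftrightarrow> \<Prod>S dvd k" for k
        by (simp add: prod_monic_irreducibles_dvd_iff[OF S])
      then show "exact_annihilator A (?F h) (\<Prod>S)"
        using A by (simp add: exact_annihilator_def *)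
    qed
  qed
  have "{v \<in> carrier_vec n. exact_annihilator A v (\<Prod>S)} = ?F ` {h \<in> polys_below n. \<forall>p\<in>S. \<not> p dvd h}"
    unfolding bij_betw_imp_surj_on[OF bij, symmetric] by (auto simp: iff)
  moreover have "inj_on ?F {h \<in> polys_below n. \<forall>p\<in>S. \<not> p dvd h}"
    using bij by (auto simp: bij_betw_def intro: inj_on_subset)
  ultimately show ?thesis
    using card_polys_below_not_dvd[OF S] deg by (simp add: card_image)
qed

subsection \<open>Companion and Krylov matrices\<close>

lemma polys_below_expansion:
  fixes g :: "'a::comm_ring_1 poly"
  assumes "g \<in> polys_below n"
  shows "g = (\<Sum>j<n. Polynomial.smult (coeff g j) (monom 1 j))"
  by (rule poly_eqI)
    (use assms in \<open>auto simp: coeff_sum polys_below_def coeff_eq_0 if_distrib[of "\<lambda>x. _ * x"] sum.delta cong: if_cong\<close>)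

lemma poly_mod_sum_smult:
  fixes f :: "'a::field poly" and n :: nat
  shows "(\<Sum>j<n. Polynomial.smult (c j) (p j)) mod f = (\<Sum>j<n. Polynomial.smult (c j) (p j mod f))"
  by (induction n) (simp_all add: poly_mod_add_left mod_smult_left)

text \<open>Column \<open>j\<close> holds the coefficients of \<open>X^(j + 1) mod f\<close>: multiplication by \<open>X\<close> on \<open>F[X]/(f)\<close>.\<close>

definition companion :: "'a::field poly \<Rightarrow> 'a mat" where
  "companion f = mat (degree f) (degree f) (\<lambda>(i, j). coeff (monom 1 (Suc j) mod f) i)"

lemma companion_carrier [simp]: "companion f \<in> carrier_mat (degree f) (degree f)"
  by (simp add: companion_def)

text \<open>By linearity in \<open>g\<close> it suffices to know the images of the powers of X,
  which are the columns of \<open>companion f\<close>.\<close>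

lemma companion_mult_vec:
  fixes f :: "'a::field poly"
  assumes g: "g \<in> polys_below (degree f)"
  shows "companion f *\<^sub>v vec (degree f) (coeff g) = vec (degree f) (coeff (pCons 0 g mod f))"
proof (rule eq_vecI)
  let ?n = "degree f"
  fix i assume i: "i < dim_vec (vec ?n (coeff (pCons 0 g mod f)))"
  have "pCons 0 g = monom 1 1 * g"
    by (simp add: monom_Suc)
  also have "\<dots> = (\<Sum>j<?n. Polynomial.smult (coeff g j) (monom 1 (Suc j)))"
    by (subst polys_below_expansion[OF g]) (simp add: sum_distrib_left mult_monom)
  finally have "pCons 0 g mod f = (\<Sum>j<?n. Polynomial.smult (coeff g j) (monom 1 (Suc j) mod f))"
    by (simp add: poly_mod_sum_smult)
  then have "coeff (pCons 0 g mod f) i = (\<Sum>j<?n. coeff (monom 1 (Suc j) mod f) i * coeff g j)"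
    by (simp add: coeff_sum mult.commute)
  then show "(companion f *\<^sub>v vec ?n (coeff g)) $ i = vec ?n (coeff (pCons 0 g mod f)) $ i"
    using i by (simp add: companion_def scalar_prod_def lessThan_atLeast0)
qed (simp add: companion_def)

text \<open>The row vector \<open>(1, X, \<dots>, X^(n - 1))\<close> is annihilated by \<open>X - C\<close> modulo \<open>f\<close>; multiplying by the
  adjugate of \<open>X - C\<close> gives \<open>f dvd char_poly C\<close>.\<close>

lemma char_poly_companion:
  fixes f :: "'a::field poly"
  assumes f: "lead_coeff f = 1"
  shows "char_poly (companion f) = f"
proof -
  define n where "n = degree f"
  define C where "C = companion f"
  define K where "K = char_poly_matrix C"
  define B where "B = adj_mat K"
  have C: "C \<in> carrier_mat n n"
    by (simp add: C_def n_def)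
  have K: "K \<in> carrier_mat n n"
    using C by (simp add: K_def)
  have B: "B \<in> carrier_mat n n" "K * B = char_poly C \<cdot>\<^sub>m 1\<^sub>m n"
    using adj_mat[OF K] by (simp_all add: B_def K_def char_poly_def)
  have deg: "degree (char_poly C) = n" "lead_coeff (char_poly C) = 1"
    using degree_monic_char_poly[OF C] by auto
  have "f dvd char_poly C"
  proof (cases "n = 0")
    case True
    then have "f = 1"
      using f by (auto simp: n_def one_pCons elim!: degree_eq_zeroE)
    then show ?thesis
      by simp
  next
    case False
    \<comment> \<open>Entry \<open>j\<close> of the row vector times X - C is X^(j + 1) minus its
      residue modulo \<open>f\<close>.\<close>
    have col: "f dvd (\<Sum>i<n. monom 1 i * K $$ (i, j))" if j: "j < n" for j
    proof -
      let ?r = "monom 1 (Suc j) mod f"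
      have r: "?r \<in> polys_below n"
        unfolding n_def using f by (intro mod_in_polys_below) auto
      have "(\<Sum>i<n. monom 1 i * K $$ (i, j)) =
          (\<Sum>i<n. (if i = j then monom 1 (Suc j) else 0) - Polynomial.smult (coeff ?r i) (monom 1 i))"
        using C j by (intro sum.cong)
          (auto simp: K_def char_poly_matrix_def C_def companion_def n_def monom_Suc algebra_simps smult_monom add_monom)
      also have "\<dots> = monom 1 (Suc j) - ?r"
        using j polys_below_expansion[OF r] by (simp add: sum_subtractf)
      finally show ?thesis
        by (simp add: minus_mod_eq_mult_div)
    qed
    \<comment> \<open>Only the first entry of the row vector times \<open>K * B\<close> is needed:
      it is \<open>char_poly C\<close> times X^0.\<close>
    have "char_poly C = (\<Sum>i<n. monom 1 i * (K * B) $$ (i, 0))"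
      using False unfolding B(2)
      by (simp add: if_distrib[of "\<lambda>x. _ * x"] sum.delta cong: if_cong)
    also have "\<dots> = (\<Sum>i<n. \<Sum>j<n. monom 1 i * K $$ (i, j) * B $$ (j, 0))"
      using False K B(1)
      by (intro sum.cong) (auto simp: scalar_prod_def lessThan_atLeast0 sum_distrib_left mult.assoc)
    also have "\<dots> = (\<Sum>j<n. (\<Sum>i<n. monom 1 i * K $$ (i, j)) * B $$ (j, 0))"
      by (subst sum.swap) (simp add: sum_distrib_right)
    also have "f dvd \<dots>"
      by (rule dvd_sum) (simp add: col dvd_mult2)
    finally show ?thesis .
  qed
  \<comment> \<open>Both polynomials are monic of degree \<open>n\<close>, so the cofactor is
    1.\<close>
  then obtain k where k: "char_poly C = f * k" ..
  then have nz: "f \<noteq> 0" "k \<noteq> 0"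
    using deg by auto
  then have "degree k = 0"
    using deg k by (simp add: n_def degree_mult_eq)
  then have "k = 1"
    using deg(2) f k by (auto simp: lead_coeff_mult one_pCons elim!: degree_eq_zeroE)
  then show ?thesis
    using k by (simp add: C_def)
qed

section \<open>Krylov matrices of cyclic pairs\<close>

text \<open>Powers of \<open>A\<close> are written as values of \<open>poly_mat\<close> at
  monomials, so that reduction of a monomial modulo \<open>f\<close> acts directly on the
  columns.\<close>

definition krylov :: "nat \<Rightarrow> 'a::comm_ring_1 mat \<Rightarrow> 'a vec \<Rightarrow> 'a mat" where
  "krylov n A v = mat n n (\<lambda>(i, j). (poly_mat A (monom 1 j) *\<^sub>v v) $ i)"

lemma krylov_carrier [simp]: "krylov n A v \<in> carrier_mat n n"
  by (simp add: krylov_def)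

lemma poly_mat_sum_vec_index:
  assumes A: "A \<in> carrier_mat n n" and v: "v \<in> carrier_vec n" and i: "i < n"
  shows "(poly_mat A (\<Sum>j<m. Polynomial.smult (c j) (p j)) *\<^sub>v v) $ i =
    (\<Sum>j<(m::nat). c j * (poly_mat A (p j) *\<^sub>v v) $ i)"
proof (induction m)
  case 0
  then show ?case
    using A v i by simp
next
  case (Suc m)
  have "(poly_mat A (p m) *\<^sub>v v) \<in> carrier_vec n" for m
    using A v by simp
  then show ?case
    using i Suc A
    by (simp add: poly_mat_add_vec[OF A v] poly_mat_smult_vec[OF A v] carrier_vecD del: index_mult_mat_vec)
qed

text \<open>The Krylov matrix represents the map from \<open>g\<close> to g(A) v in coefficient
  coordinates.\<close>

lemma krylov_mult_vec:
  assumes A: "A \<in> carrier_mat n n" and v: "v \<in> carrier_vec n" and g: "g \<in> polys_below n"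
  shows "krylov n A v *\<^sub>v vec n (coeff g) = poly_mat A g *\<^sub>v v"
proof (rule eq_vecI)
  fix i assume "i < dim_vec (poly_mat A g *\<^sub>v v)"
  then have i: "i < n"
    using A by simp
  have "(poly_mat A g *\<^sub>v v) $ i = (\<Sum>j<n. coeff g j * (poly_mat A (monom 1 j) *\<^sub>v v) $ i)"
    by (subst polys_below_expansion[OF g]) (rule poly_mat_sum_vec_index[OF A v i])
  then show "(krylov n A v *\<^sub>v vec n (coeff g)) $ i = (poly_mat A g *\<^sub>v v) $ i"
    using i by (simp add: krylov_def scalar_prod_def lessThan_atLeast0 mult.commute)
qed (use A in \<open>simp add: krylov_def\<close>)

lemma krylov_col:
  assumes A: "A \<in> carrier_mat n n" and j: "j < n"
  shows "col (krylov n A v) j = poly_mat A (monom 1 j) *\<^sub>v v"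
  using A j by (intro eq_vecI) (auto simp: krylov_def)

lemma poly_mat_pCons_0_vec:
  assumes A: "A \<in> carrier_mat n n" and v: "v \<in> carrier_vec n"
  shows "poly_mat A (pCons 0 p) *\<^sub>v v = A *\<^sub>v (poly_mat A p *\<^sub>v v)"
  using poly_mat_mult_vec[OF A v, of "[:0, 1:]" p] poly_mat_X[OF A] by simp

text \<open>Applying \<open>A\<close> to a column raises the power of X by one, and the result may
  be reduced modulo \<open>f\<close> because f(A) kills \<open>v\<close>; this is how
  \<open>companion f\<close> acts.\<close>

lemma mult_krylov:
  fixes A :: "'a::field mat"
  assumes A: "A \<in> carrier_mat n n" and v: "v \<in> carrier_vec n"
    and f: "exact_annihilator A v f" "degree f = n" "f \<noteq> 0"
  shows "A * krylov n A v = krylov n A v * companion f"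
proof (rule mat_col_eqI)
  have C: "companion f \<in> carrier_mat n n"
    using f companion_carrier[of f] by simp
  fix j assume "j < dim_col (krylov n A v * companion f)"
  then have j: "j < n"
    using C by simp
  let ?m = "monom 1 (Suc j) :: 'a poly"
  have "col (A * krylov n A v) j = A *\<^sub>v (poly_mat A (monom 1 j) *\<^sub>v v)"
    using A j by (simp add: krylov_col col_mult2[of _ n n _ n])
  also have "\<dots> = poly_mat A ?m *\<^sub>v v"
    by (simp add: monom_Suc poly_mat_pCons_0_vec[OF A v])
  also have "\<dots> = poly_mat A (?m mod f + ?m div f * f) *\<^sub>v v"
    by simp
  also have "\<dots> = poly_mat A (?m mod f) *\<^sub>v v + poly_mat A (?m div f * f) *\<^sub>v v"
    by (rule poly_mat_add_vec[OF A v])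
  also have "poly_mat A (?m div f * f) *\<^sub>v v = 0\<^sub>v n"
    using exact_annihilator_iff[OF f(1) A] by simp
  also have "poly_mat A (?m mod f) *\<^sub>v v + 0\<^sub>v n = krylov n A v *\<^sub>v vec n (coeff (?m mod f))"
    using A v f mod_in_polys_below[of f ?m] by (simp add: krylov_mult_vec[OF A v])
  also have "vec n (coeff (?m mod f)) = col (companion f) j"
    using j f by (intro eq_vecI) (auto simp: companion_def)
  finally show "col (A * krylov n A v) j = col (krylov n A v * companion f) j"
    using C j by (simp add: col_mult2[of _ n n _ n])
qed (use A f in \<open>auto simp: companion_def krylov_def\<close>)

text \<open>A kernel vector is the coefficient vector of some \<open>g\<close> of degree below
  \<open>n\<close> with g(A) v = 0. Then \<open>f\<close> divides \<open>g\<close>, so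
  \<open>g\<close> is zero.\<close>

lemma det_krylov:
  fixes A :: "'a::field mat"
  assumes A: "A \<in> carrier_mat n n" and v: "v \<in> carrier_vec n"
    and f: "exact_annihilator A v f" "degree f = n"
  shows "det (krylov n A v) \<noteq> 0"
proof
  assume "det (krylov n A v) = 0"
  then obtain w where w: "w \<in> carrier_vec n" "w \<noteq> 0\<^sub>v n" "krylov n A v *\<^sub>v w = 0\<^sub>v n"
    using det_0_iff_vec_prod_zero_field[OF krylov_carrier] by blast
  have "w \<in> (\<lambda>h. vec n (coeff h)) ` polys_below n"
    using w by (simp only: bij_betw_imp_surj_on[OF coeff_vec_bij])
  then obtain g where g: "g \<in> polys_below n" "w = vec n (coeff g)"
    by (elim imageE)
  then have "f dvd g"
    using w krylov_mult_vec[OF A v g(1)] exact_annihilator_iff[OF f(1) A] by simp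
  then have "g = 0"
    using g f polys_below_dvd_imp_0 by blast
  then have "w = 0\<^sub>v n"
    unfolding g(2) by (intro eq_vecI) auto
  then show False
    using w by simp
qed

lemma obtain_inverse_mat:
  fixes P :: "'a::field mat"
  assumes P: "P \<in> carrier_mat n n" and "det P \<noteq> 0"
  obtains B where "B \<in> carrier_mat n n" "P * B = 1\<^sub>m n" "B * P = 1\<^sub>m n"
proof -
  have "P \<in> Units (ring_mat TYPE('a) n ())"
    by (rule det_non_zero_imp_unit[OF assms])
  then show thesis
    using that by (auto simp: Units_def ring_mat_def)
qed

text \<open>This recovers \<open>A\<close> from its Krylov matrix and \<open>f\<close>. It yields
  both the similarity to \<open>companion f\<close> and the injectivity of the Krylov map.\<close>

lemma krylov_conj:
  fixes A :: "'a::field mat"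
  assumes A: "A \<in> carrier_mat n n" and v: "v \<in> carrier_vec n"
    and f: "exact_annihilator A v f" "degree f = n" "f \<noteq> 0"
    and B: "B \<in> carrier_mat n n" "krylov n A v * B = 1\<^sub>m n"
  shows "A = krylov n A v * companion f * B"
proof -
  have "A = A * (krylov n A v * B)"
    using A by (simp add: B(2))
  also have "\<dots> = A * krylov n A v * B"
    using A B by (intro assoc_mult_mat[symmetric, of _ n n _ n _ n]) auto
  finally show ?thesis
    by (simp only: mult_krylov[OF A v f])
qed

lemma char_poly_cyclic:
  fixes A :: "'a::field mat"
  assumes A: "A \<in> carrier_mat n n" and v: "v \<in> carrier_vec n"
    and f: "exact_annihilator A v f" "degree f = n" "lead_coeff f = 1"
  shows "char_poly A = f"
proof -
  have f0: "f \<noteq> 0"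
    using f by auto
  obtain B where B: "B \<in> carrier_mat n n" "krylov n A v * B = 1\<^sub>m n" "B * krylov n A v = 1\<^sub>m n"
    using obtain_inverse_mat[OF krylov_carrier det_krylov[OF A v f(1,2)]] by blast
  have "similar_mat A (companion f)"
    using A B f companion_carrier[of f] krylov_conj[OF A v f(1,2) f0 B(1,2)]
    by (intro similar_matI[of _ _ "krylov n A v" B n]) auto
  then show ?thesis
    using char_poly_similar char_poly_companion[OF f(3)] by metis
qed

text \<open>The invertible \<open>P\<close> transports multiplication by X on F[X]/(f) to the
  vectors. There \<open>v\<close> is the image of 1 and \<open>A\<close> acts as X, so h(A) v is the
  image of \<open>h\<close>.\<close>

lemma companion_conj_poly_mat_vec:
  fixes f :: "'a::field poly"
  assumes f: "f \<noteq> 0" "degree f = n" and P: "P \<in> carrier_mat n n"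
    and B: "B \<in> carrier_mat n n" "B * P = 1\<^sub>m n"
  defines "A \<equiv> P * companion f * B" and "v \<equiv> P *\<^sub>v vec n (coeff (1 mod f))"
  shows "poly_mat A h *\<^sub>v v = P *\<^sub>v vec n (coeff (h mod f))"
proof (induction h)
  have C: "companion f \<in> carrier_mat n n"
    using f companion_carrier[of f] by simp
  have A: "A \<in> carrier_mat n n"
    using P B C unfolding A_def by (intro mult_carrier_mat[of _ n n]) auto
  have v: "v \<in> carrier_vec n"
    using P unfolding v_def by (intro mult_mat_vec_carrier[of _ n n]) auto
  {
    case 0
    have "vec n (coeff (0 mod f)) = 0\<^sub>v n" "poly_mat A 0 *\<^sub>v v = 0\<^sub>v n"
      using A v by (auto intro!: eq_vecI)
    then show ?case
      by (simp only: mult_mat_zero_vec[OF P])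
  next
    case (pCons a h)
    define u where "u = vec n (coeff (h mod f))"
    have u: "u \<in> carrier_vec n"
      by (simp add: u_def)
    have "A *\<^sub>v (P *\<^sub>v u) = (P * companion f) *\<^sub>v (B *\<^sub>v (P *\<^sub>v u))"
      using P B C u unfolding A_def
      by (intro assoc_mult_mat_vec[of _ n n _ n]) (auto intro: mult_mat_vec_carrier[of _ n n])
    also have "B *\<^sub>v (P *\<^sub>v u) = u"
      using assoc_mult_mat_vec[OF B(1) P u] u by (simp add: B(2))
    also have "(P * companion f) *\<^sub>v u = P *\<^sub>v (companion f *\<^sub>v u)"
      using P C u by (intro assoc_mult_mat_vec[of _ n n _ n]) auto
    also have "companion f *\<^sub>v u = vec n (coeff (pCons 0 (h mod f) mod f))"
      using companion_mult_vec[OF mod_in_polys_below[OF f(1)]] f(2) by (simp add: u_def)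
    finally have Au: "A *\<^sub>v (P *\<^sub>v u) = P *\<^sub>v vec n (coeff (pCons 0 (h mod f) mod f))" .
    \<comment> \<open>The summand \<open>a\<close> contributes a multiple of \<open>v\<close>, and X
      h is handled by applying \<open>A\<close> to the induction hypothesis.\<close>
    have split: "pCons a h = Polynomial.smult a 1 + pCons 0 h"
      by (simp add: one_pCons)
    have "pCons 0 h mod f = pCons 0 (h mod f) mod f"
      using mod_mult_right_eq[of "[:0, 1:]" h f] by simp
    then have "pCons a h mod f = Polynomial.smult a (1 mod f) + pCons 0 (h mod f) mod f"
      by (simp only: split poly_mod_add_left mod_smult_left)
    then have "vec n (coeff (pCons a h mod f)) =
        a \<cdot>\<^sub>v vec n (coeff (1 mod f)) + vec n (coeff (pCons 0 (h mod f) mod f))"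
      by (intro eq_vecI) auto
    then have "P *\<^sub>v vec n (coeff (pCons a h mod f)) = a \<cdot>\<^sub>v v + A *\<^sub>v (P *\<^sub>v u)"
      using P unfolding Au v_def
      by (simp add: mult_add_distrib_mat_vec[of _ n n] mult_mat_vec[of _ n n])
    also have "\<dots> = poly_mat A (pCons a h) *\<^sub>v v"
      using pCons A v unfolding split
      by (simp only: poly_mat_add_vec[OF A v] poly_mat_smult_vec[OF A v] poly_mat_pCons_0_vec[OF A v]
          poly_mat_1 one_mult_mat_vec u_def)
    finally show ?case
      by simp
  }
qed

text \<open>A cyclic pair \<open>(A, v)\<close> corresponds to the basis \<open>v, A v, \<dots>, A^(n - 1) v\<close>, and every basis arises
  because \<open>A\<close> acts on it as the companion matrix.\<close>

lemma krylov_bij: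
  fixes f :: "'a::{finite,field} poly"
  assumes f: "lead_coeff f = 1" "degree f = n"
  shows "bij_betw (\<lambda>(A, v). krylov n A v)
    {(A, v). A \<in> carrier_mat n n \<and> v \<in> carrier_vec n \<and> exact_annihilator A v f}
    (GLmats TYPE('a) n)"
  (is "bij_betw ?k ?X ?G")
proof (rule bij_betw_imageI)
  have f0: "f \<noteq> 0"
    using f by auto
  show "inj_on ?k ?X"
  proof (rule inj_onI, clarify)
    fix A v A' v'
    assume A: "A \<in> carrier_mat n n" "v \<in> carrier_vec n" "exact_annihilator A v f"
      and A': "A' \<in> carrier_mat n n" "v' \<in> carrier_vec n" "exact_annihilator A' v' f"
      and eq: "krylov n A v = krylov n A' v'"
    obtain B where B: "B \<in> carrier_mat n n" "krylov n A v * B = 1\<^sub>m n" "B * krylov n A v = 1\<^sub>m n"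
      using obtain_inverse_mat[OF krylov_carrier det_krylov[OF A f(2)]] by blast
    have "A = krylov n A v * companion f * B"
      by (rule krylov_conj[OF A f(2) f0 B(1,2)])
    also have "\<dots> = A'"
      using krylov_conj[OF A' f(2) f0 B(1)] B(2) by (simp add: eq)
    finally have "A = A'" .
    \<comment> \<open>Column 0 belongs to the constant polynomial 1, so it is the vector
      itself.\<close>
    moreover have first: "w $ i = krylov n D w $$ (i, 0)"
      if "D \<in> carrier_mat n n" "w \<in> carrier_vec n" "i < n" for D and w :: "'a vec" and i
      using that by (simp add: krylov_def del: index_mult_mat_vec)
    have "v = v'"
      using A A' by (intro eq_vecI) (simp_all add: first[OF A(1,2)] first[OF A'(1,2)] eq)
    ultimately show "A = A' \<and> v = v'"
      by simp
  qed
  show "?k ` ?X = ?G"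
  proof (intro equalityI subsetI)
    fix P assume "P \<in> ?k ` ?X"
    then show "P \<in> ?G"
      using det_krylov[OF _ _ _ f(2)] by (auto simp: GLmats_def)
  next
    fix P assume "P \<in> ?G"
    then have P: "P \<in> carrier_mat n n" "det P \<noteq> 0"
      by (auto simp: GLmats_def)
    then obtain B where B: "B \<in> carrier_mat n n" "P * B = 1\<^sub>m n" "B * P = 1\<^sub>m n"
      using obtain_inverse_mat by blast
    have C: "companion f \<in> carrier_mat n n"
      using f companion_carrier[of f] by simp
    \<comment> \<open>The preimage of \<open>P\<close> sends each column to the next as
      \<open>companion f\<close> prescribes, and its vector is the image of the residue 1.\<close>
    define A where "A = P * companion f * B"
    define v where "v = P *\<^sub>v vec n (coeff (1 mod f))"
    have A: "A \<in> carrier_mat n n"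
      using P B C unfolding A_def by (intro mult_carrier_mat[of _ n n]) auto
    have v: "v \<in> carrier_vec n"
      using P unfolding v_def by (intro mult_mat_vec_carrier[of _ n n]) auto
    have act: "poly_mat A h *\<^sub>v v = P *\<^sub>v vec n (coeff (h mod f))" for h
      unfolding A_def v_def by (rule companion_conj_poly_mat_vec[OF f0 f(2) P(1) B(1,3)])
    have "poly_mat A h *\<^sub>v v = 0\<^sub>v n \<longleftrightarrow> f dvd h" for h
    proof -
      have inj: "w = 0\<^sub>v n" if "P *\<^sub>v w = 0\<^sub>v n" "w \<in> carrier_vec n" for w
        using that det_0_iff_vec_prod_zero_field[OF P(1)] P(2) by auto
      have zero: "vec n (coeff 0) = (0\<^sub>v n :: 'a vec)"
        by (intro eq_vecI) auto
      have "poly_mat A h *\<^sub>v v = 0\<^sub>v n \<longleftrightarrow> vec n (coeff (h mod f)) = 0\<^sub>v n"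
        unfolding act using inj mult_mat_zero_vec[OF P(1)] by auto
      also have "\<dots> \<longleftrightarrow> h mod f = 0"
        using inj_onD[OF bij_betw_imp_inj_on[OF coeff_vec_bij], of n "h mod f" 0]
          mod_in_polys_below[OF f0, of h] f(2) zero_in_polys_below[of n, where 'a = 'a] zero by auto
      finally show ?thesis
        by (simp add: mod_eq_0_iff_dvd)
    qed
    then have "exact_annihilator A v f"
      using A by (simp add: exact_annihilator_def)
    moreover have "krylov n A v = P"
    proof (rule mat_col_eqI)
      fix j assume "j < dim_col P"
      then have j: "j < n"
        using P by simp
      \<comment> \<open>Since \<open>j\<close> is below the degree of \<open>f\<close>, this power
        is already reduced, and its coordinates form a unit vector.\<close>
      then have "monom 1 j mod f = monom 1 j"
        using f by (intro polys_below_mod_eq) (simp add: polys_below_def degree_monom_eq)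
      then have "vec n (coeff (monom 1 j mod f)) = unit_vec n j"
        by (intro eq_vecI) (auto simp: unit_vec_def)
      moreover have "P *\<^sub>v unit_vec n j = col P j"
        using P j by (intro eq_vecI) auto
      ultimately show "col (krylov n A v) j = col P j"
        by (simp add: krylov_col[OF A j] act)
    qed (use P in \<open>auto simp: krylov_def\<close>)
    ultimately show "P \<in> ?k ` ?X"
      using A v by (intro image_eqI[of _ _ "(A, v)"]) auto
  qed
qed

section \<open>Matrices with a given squarefree characteristic polynomial\<close>

lemma finite_carrier_mat: "finite (carrier_mat m n :: 'a::finite mat set)"
proof (rule finite_subset)
  show "carrier_mat m n \<subseteq> mat m n ` (PiE ({..<m} \<times> {..<n}) (\<lambda>_. UNIV :: 'a set))"
  proof
    fix A :: "'a mat" assume "A \<in> carrier_mat m n"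
    then have "A = mat m n (\<lambda>x\<in>{..<m} \<times> {..<n}. A $$ x)"
      by (intro eq_matI) auto
    moreover have "(\<lambda>x\<in>{..<m} \<times> {..<n}. A $$ x) \<in> PiE ({..<m} \<times> {..<n}) (\<lambda>_. UNIV)"
      by simp
    ultimately show "A \<in> mat m n ` (PiE ({..<m} \<times> {..<n}) (\<lambda>_. UNIV))"
      by (rule image_eqI[where f = "mat m n"])
  qed
qed (intro finite_imageI finite_PiE, auto)

text \<open>Cyclic pairs are counted twice: the Krylov bijection gives the order of the general
  linear group, while grouping by the matrix gives the same number of generators for each matrix.
  The product form stays within the natural numbers.\<close>

lemma card_mat_with_squarefree_char_poly:
  fixes S :: "'a::{finite,field} poly set"
  assumes S: "finite S" "S \<subseteq> monic_irreducibles"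
  defines "n \<equiv> \<Sum>p\<in>S. degree p"
  shows "card {A \<in> carrier_mat n n. char_poly A = \<Prod>S} * (\<Prod>p\<in>S. card (UNIV :: 'a set) ^ degree p - 1)
    = card (GLmats TYPE('a) n)"
proof -
  let ?f = "\<Prod>S" and ?M = "{A \<in> carrier_mat n n. char_poly A = \<Prod>S}"
  let ?V = "\<lambda>A. {v \<in> carrier_vec n. exact_annihilator A v ?f}"
  have f: "lead_coeff ?f = 1" "degree ?f = n"
    using lead_coeff_prod_monic_irreducibles[OF S(2)] degree_prod_monic_irreducibles[OF S(2)] by (simp_all add: n_def)
  have "{(A, v). A \<in> carrier_mat n n \<and> v \<in> carrier_vec n \<and> exact_annihilator A v ?f} = Sigma ?M ?V"
    using char_poly_cyclic[OF _ _ _ f(2,1)] by auto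
  then have "card (GLmats TYPE('a) n) = card (Sigma ?M ?V)"
    using bij_betw_same_card[OF krylov_bij[OF f]] by simp
  also have "\<dots> = (\<Sum>A\<in>?M. card (?V A))"
    using card_finite_carrier_vec[where 'a = 'a, of n]
    by (intro card_SigmaI ballI) (auto intro: finite_subset[OF _ finite_carrier_mat[of n n]])
  also have "\<dots> = (\<Sum>A\<in>?M. \<Prod>p\<in>S. card (UNIV :: 'a set) ^ degree p - 1)"
    by (intro sum.cong) (auto simp: card_cyclic_vectors[OF _ S])
  finally show ?thesis
    by simp
qed

subsection \<open>Counting separable matrices\<close>

text \<open>For \<open>J\<close> inside \<open>monic_irreducibles\<close> these index the monic
  squarefree polynomials of degree \<open>n\<close> with all irreducible factors in
  \<open>J\<close>. Finiteness is explicit because a sum over an infinite set is 0 by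
  default.\<close>

definition factor_sets :: "'a::field poly set \<Rightarrow> nat \<Rightarrow> 'a poly set set" where
  "factor_sets J n = {S. finite S \<and> S \<subseteq> J \<and> (\<Sum>p\<in>S. degree p) = n}"

lemma degree_le_of_factor_sets: "S \<in> factor_sets J n \<Longrightarrow> p \<in> S \<Longrightarrow> degree p \<le> n"
  by (auto simp: factor_sets_def intro: member_le_sum)

lemma finite_degree_le: "finite {p \<in> (J :: 'a::{finite,field} poly set). degree p \<le> n}"
  by (rule finite_subset[OF _ finite_polys_below[of "Suc n"]]) (auto simp: polys_below_def)

lemma finite_factor_sets: "finite (factor_sets (J :: 'a::{finite,field} poly set) n)"
proof (rule finite_subset)
  show "factor_sets J n \<subseteq> Pow {p \<in> J. degree p \<le> n}"
    using degree_le_of_factor_sets by (fastforce simp: factor_sets_def)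
qed (simp add: finite_degree_le)

text \<open>Expanding the product gives a sum over subsets, and the coefficient at \<open>n\<close>
  selects those of total degree \<open>n\<close>. Their members have degree at most
  \<open>n\<close>, so any truncation \<open>M\<close> from \<open>n\<close> on gives the same
  value.\<close>

lemma fps_nth_prod_one_plus:
  fixes J :: "'a::{finite,field} poly set" and c :: "'a poly \<Rightarrow> 'b::comm_ring_1"
  assumes "n \<le> M"
  shows "fps_nth (\<Prod>p\<in>{p \<in> J. degree p \<le> M}. 1 + fps_const (c p) * fps_X ^ degree p) n
    = (\<Sum>S\<in>factor_sets J n. \<Prod>p\<in>S. c p)"
proof -
  let ?A = "{p \<in> J. degree p \<le> M}"
  have fin: "finite ?A"
    by (rule finite_degree_le)
  have prod_term: "(\<Prod>p\<in>S. fps_const (c p) * fps_X ^ degree p)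
      = fps_const (\<Prod>p\<in>S. c p) * fps_X ^ (\<Sum>p\<in>S. degree p)" if "finite S" for S
    using that by (induction S rule: finite_induct) (simp_all add: power_add algebra_simps flip: fps_const_mult)
  have "(\<Prod>p\<in>?A. 1 + fps_const (c p) * fps_X ^ degree p)
      = (\<Sum>S\<in>Pow ?A. \<Prod>p\<in>S. fps_const (c p) * fps_X ^ degree p)"
    using prod_add[OF fin, of "\<lambda>p. fps_const (c p) * fps_X ^ degree p" "\<lambda>_. 1"]
    by (simp add: add.commute)
  also have "\<dots> = (\<Sum>S\<in>Pow ?A. fps_const (\<Prod>p\<in>S. c p) * fps_X ^ (\<Sum>p\<in>S. degree p))"
    using finite_subset[OF _ fin] by (intro sum.cong prod_term) auto
  finally have "fps_nth (\<Prod>p\<in>?A. 1 + fps_const (c p) * fps_X ^ degree p) n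
      = (\<Sum>S\<in>Pow ?A. if (\<Sum>p\<in>S. degree p) = n then \<Prod>p\<in>S. c p else 0)"
    by (auto simp: fps_sum_nth intro!: sum.cong)
  also have "\<dots> = (\<Sum>S\<in>{S \<in> Pow ?A. (\<Sum>p\<in>S. degree p) = n}. \<Prod>p\<in>S. c p)"
    using fin by (intro sum.inter_filter[symmetric]) simp
  also have "{S \<in> Pow ?A. (\<Sum>p\<in>S. degree p) = n} = factor_sets J n"
  proof (intro equalityI subsetI)
    fix S assume "S \<in> {S \<in> Pow ?A. (\<Sum>p\<in>S. degree p) = n}"
    then show "S \<in> factor_sets J n"
      using finite_subset[OF _ fin, of S] by (auto simp: factor_sets_def)
  next
    fix S assume S: "S \<in> factor_sets J n"
    then show "S \<in> {S \<in> Pow ?A. (\<Sum>p\<in>S. degree p) = n}"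
      using degree_le_of_factor_sets[OF S] assms by (fastforce simp: factor_sets_def)
  qed
  finally show ?thesis .
qed

lemma one_less_card_field: "1 < card (UNIV :: 'a::{finite,field} set)"
proof -
  have "card {0, 1 :: 'a} \<le> card (UNIV :: 'a set)"
    by (intro card_mono) auto
  then show ?thesis
    by simp
qed

lemma card_GLmats_pos: "0 < card (GLmats TYPE('a::{finite,field}) n)"
proof -
  have "finite (GLmats TYPE('a) n)" "1\<^sub>m n \<in> GLmats TYPE('a) n"
    by (auto simp: GLmats_def finite_carrier_mat)
  then show ?thesis
    by (auto simp: card_gt_0_iff)
qed

lemma card_mat_factor_sets:
  fixes J :: "'a::{finite,field} poly set"
  assumes J: "J \<subseteq> monic_irreducibles"
  shows "real (card {A \<in> carrier_mat n n. \<exists>S\<in>factor_sets J n. char_poly A = \<Prod>S})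
    = real (card (GLmats TYPE('a) n)) *
      (\<Sum>S\<in>factor_sets J n. \<Prod>p\<in>S. 1 / (real (card (UNIV :: 'a set)) ^ degree p - 1))"
proof -
  let ?q = "card (UNIV :: 'a set)" and ?M = "\<lambda>S. {A \<in> carrier_mat n n. char_poly A = \<Prod>(S :: 'a poly set)}"
  have fin: "finite (?M S)" for S
    by (simp add: finite_carrier_mat)
  have "card {A \<in> carrier_mat n n. \<exists>S\<in>factor_sets J n. char_poly A = \<Prod>S}
      = card (\<Union>S\<in>factor_sets J n. ?M S)"
    by (intro arg_cong[of _ _ card]) auto
  also have "\<dots> = (\<Sum>S\<in>factor_sets J n. card (?M S))"
  proof (intro card_UN_disjoint ballI impI)
    fix S R assume SR: "S \<in> factor_sets J n" "R \<in> factor_sets J n" "S \<noteq> R"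
    then have "\<Prod>S \<noteq> \<Prod>R"
      using J inj_onD[OF prod_monic_irreducibles_inj, of S R] by (auto simp: factor_sets_def)
    then show "?M S \<inter> ?M R = {}"
      by auto
  qed (auto simp: fin finite_factor_sets)
  finally have "real (card {A \<in> carrier_mat n n. \<exists>S\<in>factor_sets J n. char_poly A = \<Prod>S})
      = (\<Sum>S\<in>factor_sets J n. real (card (?M S)))"
    by simp
  also have "\<dots> = (\<Sum>S\<in>factor_sets J n. real (card (GLmats TYPE('a) n)) *
      (\<Prod>p\<in>S. 1 / (real ?q ^ degree p - 1)))"
  proof (rule sum.cong[OF refl])
    fix S assume "S \<in> factor_sets J n"
    then have S: "finite S" "S \<subseteq> monic_irreducibles" "(\<Sum>p\<in>S. degree p) = n"
      using J by (auto simp: factor_sets_def)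
    \<comment> \<open>This makes the truncated subtraction agree with the real one and keeps all
      denominators nonzero.\<close>
    have pos: "1 < ?q ^ degree p" if "p \<in> S" for p
    proof -
      have "0 < degree p"
        using that S(2) by (intro monic_irreducibles_degree_pos) auto
      then show ?thesis
        by (intro one_less_power one_less_card_field)
    qed
    have "real (\<Prod>p\<in>S. ?q ^ degree p - 1) = (\<Prod>p\<in>S. real ?q ^ degree p - 1)"
      unfolding of_nat_prod
    proof (rule prod.cong[OF refl])
      fix p assume "p \<in> S"
      then show "real (?q ^ degree p - 1) = real ?q ^ degree p - 1"
        using pos[of p] by (simp add: of_nat_diff)
    qed
    moreover have "real (card (?M S)) * real (\<Prod>p\<in>S. ?q ^ degree p - 1) = real (card (GLmats TYPE('a) n))"
      unfolding of_nat_mult[symmetric]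
      using card_mat_with_squarefree_char_poly[OF S(1,2)] by (simp only: S(3))
    moreover have "(\<Prod>p\<in>S. real ?q ^ degree p - 1) \<noteq> 0"
    proof -
      have "real ?q ^ degree p \<noteq> 1" if "p \<in> S" for p
        using pos[OF that] by (metis nat_neq_iff of_nat_1 of_nat_eq_iff of_nat_power)
      then show ?thesis
        using S(1) by simp
    qed
    ultimately show "real (card (?M S)) = real (card (GLmats TYPE('a) n)) *
        (\<Prod>p\<in>S. 1 / (real ?q ^ degree p - 1))"
      by (simp add: prod_dividef field_simps)
  qed
  finally show ?thesis
    by (simp add: sum_distrib_left)
qed

lemma linear_in_monic_irreducibles: "[:a, 1:] \<in> monic_irreducibles"
  by (simp add: monic_irreducibles_def irreducible_linear_field_poly)

text \<open>The value of the characteristic polynomial at 0 is the determinant of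
  \<open>- A\<close>.\<close>

lemma det_eq_0_iff_dvd_char_poly:
  fixes A :: "'a::field mat"
  assumes A: "A \<in> carrier_mat n n"
  shows "det A = 0 \<longleftrightarrow> [:0, 1:] dvd char_poly A"
proof -
  have "char_matrix A 0 = A"
    using A by (intro eq_matI) (auto simp: char_matrix_def)
  then have "poly (char_poly A) 0 = det (- A)"
    using char_poly_matrix[OF A, of 0] by simp
  then show ?thesis
    using det_0_negate[OF A] poly_eq_0_iff_dvd[of "char_poly A" 0] by simp
qed

lemma squarefree_char_poly_iff:
  fixes A :: "'a::field mat"
  assumes A: "A \<in> carrier_mat n n"
  shows "squarefree (char_poly A) \<longleftrightarrow> (\<exists>S\<in>factor_sets monic_irreducibles n. char_poly A = \<Prod>S)"
proof
  assume "squarefree (char_poly A)"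
  moreover have "lead_coeff (char_poly A) = 1" "degree (char_poly A) = n"
    using degree_monic_char_poly[OF A] by auto
  ultimately obtain S where S: "finite S" "S \<subseteq> monic_irreducibles" "char_poly A = \<Prod>S"
    using squarefree_imp_prod_monic_irreducibles by blast
  then have "S \<in> factor_sets monic_irreducibles n"
    using \<open>degree (char_poly A) = n\<close> degree_prod_monic_irreducibles[OF S(2)] by (simp add: factor_sets_def)
  then show "\<exists>S\<in>factor_sets monic_irreducibles n. char_poly A = \<Prod>S"
    using S by blast
qed (auto simp: factor_sets_def squarefree_prod_monic_irreducibles)

lemma factor_sets_Diff: "factor_sets (J - K) n = {S \<in> factor_sets J n. S \<inter> K = {}}"
  by (auto simp: factor_sets_def)

text \<open>Separability provides the factor set, and invertibility excludes X from it.\<close>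

lemma separable_GLmats:
  "{A \<in> GLmats TYPE('a::{finite,field}) n. separable_mat A} =
    {A \<in> carrier_mat n n. \<exists>S\<in>factor_sets (monic_irreducibles - {[:0, 1:]}) n. char_poly A = \<Prod>S}"
proof -
  have det: "det A \<noteq> 0 \<longleftrightarrow> [:0, 1:] \<notin> S"
    if "A \<in> carrier_mat n n" "S \<in> factor_sets monic_irreducibles n" "char_poly A = \<Prod>S"
    for A :: "'a mat" and S
    using that monic_irreducible_dvd_prod_iff[of S "[:0, 1:]"] linear_in_monic_irreducibles[of "0::'a"]
    by (simp add: det_eq_0_iff_dvd_char_poly[OF that(1)] factor_sets_def)
  show ?thesis
  proof (rule Collect_cong)
    fix A :: "'a mat"
    show "A \<in> GLmats TYPE('a) n \<and> separable_mat A \<longleftrightarrow> A \<in> carrier_mat n n \<and>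
        (\<exists>S\<in>factor_sets (monic_irreducibles - {[:0, 1:]}) n. char_poly A = \<Prod>S)"
    proof (cases "A \<in> carrier_mat n n")
      case True
      show ?thesis
        using squarefree_char_poly_iff[OF True] det[OF True]
        unfolding GLmats_def separable_mat_def factor_sets_Diff by blast
    qed (simp add: GLmats_def)
  qed
qed

lemma s_GL_eq:
  "s_GL TYPE('a::{finite,field}) n = (\<Sum>S\<in>factor_sets (monic_irreducibles - {[:0, 1:] :: 'a poly}) n.
    \<Prod>p\<in>S. 1 / (real (card (UNIV :: 'a set)) ^ degree p - 1))"
proof -
  have "monic_irreducibles - {[:0, 1:] :: 'a poly} \<subseteq> monic_irreducibles"
    by auto
  from card_mat_factor_sets[OF this, of n] show ?thesis
    using card_GLmats_pos[where 'a = 'a, of n] unfolding s_GL_def separable_GLmats by simp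
qed

subsection \<open>The affine group\<close>

definition affine_block :: "'a::field vec \<times> 'a mat \<Rightarrow> 'a mat" where
  "affine_block = (\<lambda>(v, y).
    four_block_mat (1\<^sub>m 1) (mat 1 (dim_vec v) (\<lambda>(i, j). v $ j)) (0\<^sub>m (dim_vec v) 1) y)"

lemma char_poly_affine_block:
  assumes "v \<in> carrier_vec n" "y \<in> carrier_mat n n"
  shows "char_poly (affine_block (v, y)) = [:-1, 1:] * char_poly y"
proof -
  have "char_poly (1\<^sub>m 1 :: 'a::field mat) = [:-1, 1:]"
    unfolding char_poly_def by (subst det_single) (auto simp: char_poly_matrix_def)
  then show ?thesis
    using assms char_poly_four_block_zeros_col[of "1\<^sub>m 1" _ n y] by (simp add: affine_block_def)
qed

text \<open>The block matrix is triangular with determinant \<open>det y\<close>, so invertibility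
  constrains only \<open>y\<close> and the vector is free.\<close>

lemma affine_block_bij:
  "bij_betw affine_block (carrier_vec n \<times> GLmats TYPE('a::{finite,field}) n) (Amats TYPE('a) n)"
proof (rule bij_betw_byWitness[where
      f' = "\<lambda>x. (vec n (\<lambda>j. x $$ (0, Suc j)), mat n n (\<lambda>(i, j). x $$ (Suc i, Suc j)))"])
  have det: "det (affine_block (v, y)) = det y" if "v \<in> carrier_vec n" "y \<in> carrier_mat n n"
    for v :: "'a vec" and y
    using that det_four_block_mat_lower_left_zero_col[of "1\<^sub>m 1" _ n _ y] by (simp add: affine_block_def)
  have carrier: "affine_block (v, y) \<in> carrier_mat (n + 1) (n + 1)"
    if "v \<in> carrier_vec n" "y \<in> carrier_mat n n" for v :: "'a vec" and y
    using that four_block_carrier_mat[of "1\<^sub>m 1" 1 1 y n n] by (simp add: affine_block_def)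
  have inv: "affine_block (vec n (\<lambda>j. x $$ (0, Suc j)), mat n n (\<lambda>(i, j). x $$ (Suc i, Suc j))) = x"
    if "x \<in> Amats TYPE('a) n" for x
    using that by (intro eq_matI)
      (auto simp: affine_block_def Amats_def GLmats_def four_block_mat_def Let_def)
  show "\<forall>(x :: 'a vec \<times> 'a mat)\<in>carrier_vec n \<times> GLmats TYPE('a) n.
      (vec n (\<lambda>j. affine_block x $$ (0, Suc j)),
       mat n n (\<lambda>(i, j). affine_block x $$ (Suc i, Suc j))) = x"
    by (auto simp: affine_block_def GLmats_def four_block_mat_def Let_def intro!: eq_vecI eq_matI)
  show "\<forall>x\<in>Amats TYPE('a) n.
      affine_block (vec n (\<lambda>j. x $$ (0, Suc j)), mat n n (\<lambda>(i, j). x $$ (Suc i, Suc j))) = x"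
    using inv by blast
  show "affine_block ` (carrier_vec n \<times> GLmats TYPE('a) n) \<subseteq> Amats TYPE('a) n"
    using det carrier
    by (auto simp: Amats_def GLmats_def) (auto simp: affine_block_def four_block_mat_def Let_def)
  show "(\<lambda>x. (vec n (\<lambda>j. x $$ (0, Suc j)), mat n n (\<lambda>(i, j). x $$ (Suc i, Suc j)))) ` Amats TYPE('a) n
      \<subseteq> carrier_vec n \<times> GLmats TYPE('a) n"
  proof safe
    fix x :: "'a mat" assume x: "x \<in> Amats TYPE('a) n"
    then have "det (mat n n (\<lambda>(i, j). x $$ (Suc i, Suc j))) \<noteq> 0"
      using inv[OF x] det[of "vec n (\<lambda>j. x $$ (0, Suc j))" "mat n n (\<lambda>(i, j). x $$ (Suc i, Suc j))"]
      by (auto simp: Amats_def GLmats_def)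
    then show "mat n n (\<lambda>(i, j). x $$ (Suc i, Suc j)) \<in> GLmats TYPE('a) n"
      by (simp add: GLmats_def)
  qed auto
qed

text \<open>The extra factor X - 1 in the characteristic polynomial must not occur in that of
  \<open>y\<close>, and X is excluded because \<open>y\<close> is invertible.\<close>

lemma separable_affine_block_iff:
  fixes y :: "'a::{finite,field} mat"
  assumes v: "v \<in> carrier_vec n" and y: "y \<in> GLmats TYPE('a) n"
  shows "separable_mat (affine_block (v, y)) \<longleftrightarrow>
    (\<exists>S\<in>factor_sets (monic_irreducibles - {[:0, 1:], [:-1, 1:]}) n. char_poly y = \<Prod>S)"
proof -
  let ?l = "[:-1, 1:] :: 'a poly"
  have l: "?l \<in> monic_irreducibles" "\<not> is_unit ?l"
    by (rule linear_in_monic_irreducibles) (simp add: is_unit_iff_degree)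
  have yc: "y \<in> carrier_mat n n"
    using y by (simp add: GLmats_def)
  have sq: "squarefree (?l * char_poly y) \<longleftrightarrow> separable_mat y \<and> \<not> ?l dvd char_poly y"
  proof
    assume sq: "squarefree (?l * char_poly y)"
    have "\<not> ?l dvd char_poly y"
    proof
      assume "?l dvd char_poly y"
      then have "?l\<^sup>2 dvd ?l * char_poly y"
        unfolding power2_eq_square by (rule mult_dvd_mono[OF dvd_refl])
      then show False
        using squarefreeD[OF sq] l(2) by blast
    qed
    then show "separable_mat y \<and> \<not> ?l dvd char_poly y"
      using squarefree_multD(2)[OF sq] by (simp add: separable_mat_def)
  next
    assume sep: "separable_mat y \<and> \<not> ?l dvd char_poly y"
    then obtain S where S: "finite S" "S \<subseteq> monic_irreducibles" "char_poly y = \<Prod>S"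
      using squarefree_char_poly_iff[OF yc] by (auto simp: separable_mat_def factor_sets_def)
    then have "?l \<notin> S"
      using sep monic_irreducible_dvd_prod_iff[OF S(1,2) l(1)] by simp
    then have "?l * char_poly y = \<Prod>(insert ?l S)"
      using S by simp
    then show "squarefree (?l * char_poly y)"
      using squarefree_prod_monic_irreducibles[of "insert ?l S"] S l(1) by simp
  qed
  have sep: "separable_mat y \<longleftrightarrow>
      (\<exists>S\<in>factor_sets (monic_irreducibles - {[:0, 1:]}) n. char_poly y = \<Prod>S)"
    using separable_GLmats[where 'a = 'a, of n] y yc by blast
  have dvd: "?l dvd char_poly y \<longleftrightarrow> ?l \<in> S"
    if "S \<in> factor_sets (monic_irreducibles - {[:0, 1:]}) n" "char_poly y = \<Prod>S" for S
  proof -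
    have "finite S" "S \<subseteq> monic_irreducibles"
      using that by (auto simp: factor_sets_def)
    then show ?thesis
      using that monic_irreducible_dvd_prod_iff l(1) by simp
  qed
  have sets: "factor_sets (monic_irreducibles - {[:0, 1:], ?l}) n =
      {S \<in> factor_sets (monic_irreducibles - {[:0, 1:]}) n. ?l \<notin> S}"
    by (auto simp: factor_sets_def)
  show ?thesis
    unfolding separable_mat_def[of "affine_block (v, y)"] char_poly_affine_block[OF v yc] sq sep sets
    using dvd by blast
qed

text \<open>Separability does not depend on the vector in the block, so the number of vectors
  cancels and a proportion within the general linear group remains.\<close>

lemma s_A_eq:
  "s_A TYPE('a::{finite,field}) n = (\<Sum>S\<in>factor_sets (monic_irreducibles - {[:0, 1:], [:-1, 1:] :: 'a poly}) n.
    \<Prod>p\<in>S. 1 / (real (card (UNIV :: 'a set)) ^ degree p - 1))"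
proof -
  let ?J = "monic_irreducibles - {[:0, 1:], [:-1, 1:] :: 'a poly}"
  let ?V = "carrier_vec n :: 'a vec set" and ?G = "GLmats TYPE('a) n"
  define Y where "Y = {y \<in> carrier_mat n n. \<exists>S\<in>factor_sets ?J n. char_poly y = \<Prod>S}"
  note bij = affine_block_bij[where 'a = 'a, of n]
  have sub: "Y \<subseteq> ?G"
  proof
    fix y assume "y \<in> Y"
    then have "y \<in> {A \<in> ?G. separable_mat A}"
      unfolding separable_GLmats by (auto simp: Y_def factor_sets_def)
    then show "y \<in> ?G"
      by simp
  qed
  have "separable_mat (affine_block (v, y)) \<longleftrightarrow> y \<in> Y" if "v \<in> ?V" "y \<in> ?G" for v y
    using that separable_affine_block_iff[OF that] by (simp add: Y_def GLmats_def)
  then have "{x \<in> affine_block ` (?V \<times> ?G). separable_mat x} = affine_block ` (?V \<times> Y)"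
    using sub by blast
  then have "{x \<in> Amats TYPE('a) n. separable_mat x} = affine_block ` (?V \<times> Y)"
    by (simp only: bij_betw_imp_surj_on[OF bij])
  moreover have "inj_on affine_block (?V \<times> Y)"
    using sub by (intro inj_on_subset[OF bij_betw_imp_inj_on[OF bij]]) auto
  ultimately have "card {x \<in> Amats TYPE('a) n. separable_mat x} = card ?V * card Y"
    by (simp add: card_image card_cartesian_product)
  moreover have "card (Amats TYPE('a) n) = card ?V * card ?G"
    using bij_betw_same_card[OF bij] by (simp add: card_cartesian_product)
  moreover have "card ?V \<noteq> 0"
    using card_finite_carrier_vec[where 'a = 'a, of n] by simp
  ultimately have s_A: "s_A TYPE('a) n = real (card Y) / real (card ?G)"
    by (simp add: s_A_def)
  have "?J \<subseteq> monic_irreducibles"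
    by auto
  from card_mat_factor_sets[OF this, of n, folded Y_def] show ?thesis
    using card_GLmats_pos[where 'a = 'a, of n] by (simp add: s_A)
qed

text \<open>The two removed polynomials X and X - 1 are distinct and linear, which accounts for the
  2 subtracted at \<open>d = 1\<close>.\<close>

lemma card_degree_eq_N':
  "card {p \<in> monic_irreducibles - {[:0, 1:], [:-1, 1:] :: 'a::{finite,field} poly}. degree p = d} = N' TYPE('a) d"
proof -
  let ?P = "{p :: 'a poly. lead_coeff p = 1 \<and> irreducible p \<and> degree p = d}"
  have eq: "{p \<in> monic_irreducibles - {[:0, 1:], [:-1, 1:] :: 'a poly}. degree p = d} = ?P - {[:0, 1:], [:-1, 1:]}"
    by (auto simp: monic_irreducibles_def)
  show ?thesis
  proof (cases "d = 1")
    case True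
    have "{[:0, 1:], [:-1, 1:]} \<subseteq> ?P"
      using True by (simp add: irreducible_linear_field_poly)
    then show ?thesis
      unfolding eq using True by (simp add: card_Diff_subset N'_def N_irr_def)
  next
    case False
    then have "?P - {[:0, 1:], [:-1, 1:]} = ?P"
      by auto
    then show ?thesis
      unfolding eq using False by (simp add: N'_def N_irr_def)
  qed
qed

section \<open>Euler products and the relation between the two series\<close>

text \<open>The factors are grouped by degree; the index starts at 1 because irreducibles have
  positive degree.\<close>

lemma prod_power_N':
  fixes c :: "nat \<Rightarrow> real"
  shows "(\<Prod>d\<in>{1..M}. (1 + fps_const (c d) * fps_X ^ d) ^ N' TYPE('a::{finite,field}) d) =
    (\<Prod>p\<in>{p \<in> monic_irreducibles - {[:0, 1:], [:-1, 1:] :: 'a poly}. degree p \<le> M}.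
      1 + fps_const (c (degree p)) * fps_X ^ degree p)"
proof -
  let ?J = "monic_irreducibles - {[:0, 1:], [:-1, 1:] :: 'a poly}"
  let ?fac = "\<lambda>d. 1 + fps_const (c d) * fps_X ^ d"
  have "degree ` {p \<in> ?J. degree p \<le> M} \<subseteq> {1..M}"
    using monic_irreducibles_degree_pos by fastforce
  then have "(\<Prod>p\<in>{p \<in> ?J. degree p \<le> M}. ?fac (degree p)) =
      (\<Prod>d\<in>{1..M}. \<Prod>p\<in>{x \<in> {p \<in> ?J. degree p \<le> M}. degree x = d}. ?fac (degree p))"
    by (intro prod.group[symmetric] finite_degree_le finite_atLeastAtMost)
  also have "\<dots> = (\<Prod>d\<in>{1..M}. \<Prod>p\<in>{p \<in> ?J. degree p = d}. ?fac d)"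
    by (intro prod.cong) auto
  also have "\<dots> = (\<Prod>d\<in>{1..M}. ?fac d ^ N' TYPE('a) d)"
    by (simp only: prod_constant card_degree_eq_N')
  finally show ?thesis ..
qed

lemma fps_nth_S_A:
  assumes "n \<le> M"
  shows "fps_nth (S_A TYPE('a::{finite,field})) n = fps_nth
    (\<Prod>p\<in>{p \<in> monic_irreducibles - {[:0, 1:], [:-1, 1:] :: 'a poly}. degree p \<le> M}.
      1 + fps_const (1 / (real (card (UNIV :: 'a set)) ^ degree p - 1)) * fps_X ^ degree p) n"
  by (simp only: fps_nth_prod_one_plus[OF assms] S_A_def fps_nth_Abs_fps s_A_eq)

lemma fps_nth_S_GL:
  assumes "n \<le> M"
  shows "fps_nth (S_GL TYPE('a::{finite,field})) n = fps_nth
    (\<Prod>p\<in>{p \<in> monic_irreducibles - {[:0, 1:] :: 'a poly}. degree p \<le> M}.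
      1 + fps_const (1 / (real (card (UNIV :: 'a set)) ^ degree p - 1)) * fps_X ^ degree p) n"
  by (simp only: fps_nth_prod_one_plus[OF assms] S_GL_def fps_nth_Abs_fps s_GL_eq)

text \<open>Convergence of formal power series means that each coefficient is eventually constant;
  here coefficient \<open>n\<close> is constant from \<open>M = n\<close> on.\<close>

lemma euler_product_tendsto_S_A:
  "(\<lambda>M. \<Prod>d\<in>{1..M}. (1 + fps_const (1 / (real (card (UNIV :: 'a set)) ^ d - 1)) * fps_X ^ d)
      ^ N' TYPE('a::{finite,field}) d) \<longlonglongrightarrow> S_A TYPE('a)"
  unfolding prod_power_N' tendsto_fps_iff
proof
  fix n
  show "\<forall>\<^sub>F M in sequentially. fps_nth
      (\<Prod>p\<in>{p \<in> monic_irreducibles - {[:0, 1:], [:-1, 1:] :: 'a poly}. degree p \<le> M}.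
        1 + fps_const (1 / (real (card (UNIV :: 'a set)) ^ degree p - 1)) * fps_X ^ degree p) n
    = fps_nth (S_A TYPE('a)) n"
    using eventually_ge_at_top[of n] by eventually_elim (rule fps_nth_S_A[symmetric])
qed

text \<open>The two index sets differ only in X - 1, whose Euler factor is the first factor on the
  right. The comparison is made coefficientwise on finite truncations.\<close>

lemma S_GL_eq_mult_S_A:
  "S_GL TYPE('a::{finite,field}) =
    (1 + fps_const (1 / (real (card (UNIV :: 'a set)) - 1)) * fps_X) * S_A TYPE('a)"
proof (rule fps_ext)
  fix n
  let ?l = "[:-1, 1:] :: 'a poly" and ?u = "1 + fps_const (1 / (real (card (UNIV :: 'a set)) - 1)) * fps_X"
  let ?fac = "\<lambda>p :: 'a poly.
    1 + fps_const (1 / (real (card (UNIV :: 'a set)) ^ degree p - 1)) * fps_X ^ degree p"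
  \<comment> \<open>The bound \<open>Suc n\<close> instead of \<open>n\<close> keeps X - 1 inside
    the truncation even for \<open>n = 0\<close>.\<close>
  define JA where "JA = {p \<in> monic_irreducibles - {[:0, 1:], ?l}. degree p \<le> Suc n}"
  define JG where "JG = {p \<in> monic_irreducibles - {[:0, 1:] :: 'a poly}. degree p \<le> Suc n}"
  have nth_A: "fps_nth (S_A TYPE('a)) i = fps_nth (\<Prod>p\<in>JA. ?fac p) i" if "i \<le> n" for i
    unfolding JA_def using that by (intro fps_nth_S_A) simp
  have "JG = insert ?l JA" "?l \<notin> JA"
    using linear_in_monic_irreducibles[of "-1 :: 'a"] by (auto simp: JG_def JA_def)
  moreover have "finite JA"
    unfolding JA_def by (rule finite_degree_le)
  ultimately have "(\<Prod>p\<in>JG. ?fac p) = ?u * (\<Prod>p\<in>JA. ?fac p)"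
    by simp
  moreover have "fps_nth (S_GL TYPE('a)) n = fps_nth (\<Prod>p\<in>JG. ?fac p) n"
    unfolding JG_def by (rule fps_nth_S_GL) simp
  ultimately have "fps_nth (S_GL TYPE('a)) n = fps_nth (?u * (\<Prod>p\<in>JA. ?fac p)) n"
    by (simp only:)
  also have "\<dots> = (\<Sum>i=0..n. fps_nth ?u i * fps_nth (\<Prod>p\<in>JA. ?fac p) (n - i))"
    by (rule fps_mult_nth)
  also have "\<dots> = (\<Sum>i=0..n. fps_nth ?u i * fps_nth (S_A TYPE('a)) (n - i))"
    by (intro sum.cong) (simp_all only: nth_A diff_le_self)
  also have "\<dots> = fps_nth (?u * S_A TYPE('a)) n"
    by (rule fps_mult_nth[symmetric])
  finally show "fps_nth (S_GL TYPE('a)) n = fps_nth (?u * S_A TYPE('a)) n" .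
qed

lemma one_plus_const_fps_X_nonzero: "1 + fps_const (c :: real) * fps_X \<noteq> 0"
proof -
  have "fps_nth (1 + fps_const c * fps_X) 0 = 1"
    by simp
  then show ?thesis
    by (metis fps_zero_nth zero_neq_one)
qed

text \<open>The axioms of \<open>itself\<close> do not provide \<open>T = TYPE('a)\<close>, but no definition looks at its argument.\<close>

lemma itself_irrelevant:
  fixes T :: "'a::{finite,field} itself"
  shows "N' T = N' TYPE('a)" "S_A T = S_A TYPE('a)" "S_GL T = S_GL TYPE('a)"
proof -
  have GL: "GLmats T = GLmats TYPE('a)"
    by (simp add: fun_eq_iff GLmats_def)
  moreover have "Amats T = Amats TYPE('a)"
    by (simp add: fun_eq_iff Amats_def GL)
  ultimately show "S_A T = S_A TYPE('a)" "S_GL T = S_GL TYPE('a)"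
    by (simp_all add: fps_eq_iff S_A_def S_GL_def s_A_def s_GL_def)
  show "N' T = N' TYPE('a)"
    by (simp add: fun_eq_iff N'_def N_irr_def)
qed

theorem theorem5p3:
  fixes T :: "'a::{finite,field} itself"
  defines "q \<equiv> real (card (UNIV :: 'a set))"
  shows "((\<lambda>M. \<Prod>d\<in>{1..M}. (1 + fps_const (1 / (q ^ d - 1)) * fps_X ^ d) ^ N' T d)
           \<longlonglongrightarrow> S_A T)
         \<and> S_A T = S_GL T / (1 + fps_const (1 / (q - 1)) * fps_X)"
  unfolding itself_irrelevant[of T] q_def S_GL_eq_mult_S_A
  using euler_product_tendsto_S_A[where 'a = 'a]
  by (simp only: nonzero_mult_div_cancel_left[OF one_plus_const_fps_X_nonzero] simp_thms)

end
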